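(* Let $\mathcal L=(K,\mathsf X,\{F_i\}_{i\in\mathsf X})$ be a post-critically finite self-similar structure with associated continuous surjection $\pi:\mathsf X^{-\omega}\to K$. Then there exists a contracting self-similar action $(G,\mathsf X)$ such that its limit space $\mathcal J_G$ has a self-similar structure $\mathcal L'=(\mathcal J_G,\mathsf X,\{F_i'\}_{i\in\mathsf X})$ (with associated surjection the quotient map $p:\mathsf X^{-\omega}\to\mathcal J_G$) that is isomorphic to $\mathcal L$, if and only if the induced shift map $\mathsf s:K\to K$ given by $\mathsf s\circ\pi=\pi\circ\sigma$ is well-defined.
   Context: Let $\mathsf X$ be a finite set (the alphabet). $\mathsf X^*$ is the set of finite words $x_n\ldots x_2x_1$ over $\mathsf X$ (including the empty word $\varnothing$), a rooted tree with root $\varnothing$ in which $w$ is joined to $wx$ for $x\in\mathsf X$. $\mathsf X^{-\omega}$ is the set of left-infinite words $\ldots x_2x_1$ with the product topology ($\mathsf X$ discrete), and $\sigma:\mathsf X^{-\omega}\to\mathsf X^{-\omega}$ is the shift $\sigma(\ldots x_2x_1)=\ldots x_3x_2$. A self-similar structure on a compact metrizable space $K$ is a system $\mathcal L=(K,\mathsf X,\{F_i\}_{i\in\mathsf X})$ of continuous injections $F_i:K\to K$ for which there is a continuous surjection $\pi:\mathsf X^{-\omega}\to K$ with $F_i\circ\pi=\pi\circ i$ for all $i\in\mathsf X$, where $i(\ldots x_2x_1)=\ldots x_2x_1i$; $\pi$ is unique and is called the associated surjection. Put $K_i=F_i(K)$. The critical set is $\mathcal C=\pi^{-1}\bigl(\bigcup_{i\ne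 j}(K_i\cap K_j)\bigr)$ and the post-critical set is $\mathcal P=\bigcup_{n\ge1}\sigma^n(\mathcal C)$. $\mathcal L$ is post-critically finite if $\mathcal P$ is finite. Two self-similar structures $\mathcal L_j=(K_j,\mathsf X_j,\{F^{(j)}_i\}_{i\in\mathsf X_j})$, $j=1,2$, with associated surjections $\pi_j$, are isomorphic if there is a bijection $\rho:\mathsf X_1\to\mathsf X_2$ such that $\pi_2\circ\iota_\rho\circ\pi_1^{-1}$ is a well-defined homeomorphism between $K_1$ and $K_2$, where $\iota_\rho(\ldots x_2x_1)=\ldots\rho(x_2)\rho(x_1)$. For $g\in\operatorname{Aut}\mathsf X^*$ (rooted tree automorphisms) and $v\in\mathsf X^*$ the restriction $g|_v$ is defined by $g(vw)=g(v)\,g|_v(w)$ for all $w\in\mathsf X^*$ (words are read from left to right). A self-similar action $(G,\mathsf X)$ is a faithful action of a group $G$ on $\mathsf X^*$ by automorphisms (so $G\le\operatorname{Aut}\mathsf X^*$) such that $g|_x\in G$ for all $g\in G$, $x\in\mathsf X$. It is contracting if there is a finite set $\mathcal N\subset G$ such that for every $g\in G$ there is $k\in\mathbb N$ with $g|_w\in\mathcal N$ whenever $|w|\ge k$. Two words $\ldots x_2x_1,\ \ldots y_2y_1\in\mathsf X^{-\omega}$ are asymptotically equivalent if there is a sequence $(g_k)_{k\ge1}$ in $G$, taking only finitely many values, with $g_k(x_k\ldots x_1)=y_k\ldots y_1$ for all $k$. The limit space $\mathcal J_G$ is the quotient topological space of $\mathsf X^{-\omega}$ by this relation, with quotient map $p$.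 *)

theory Defs
  imports "HOL-Analysis.Analysis" "HOL-Algebra.Bij"
begin

text \<open>
  A left-infinite word \<open>\<dots>x\<^sub>2x\<^sub>1\<close> is the function \<open>w\<close> with \<open>w n = x\<^sub>n\<^sub>+\<^sub>1\<close>, so the last
  letter is \<open>w 0\<close>.  A finite word is the list of its letters read from left to right.
  The alphabet is a carrier set, and spaces are abstract topologies, so that the limit space
  can be the honest quotient space, whose points are the equivalence classes.
\<close>

definition left_words :: "'x set \<Rightarrow> (nat \<Rightarrow> 'x) topology" where
  "left_words X = product_topology (\<lambda>_. discrete_topology X) UNIV"

definition append_letter :: "'x \<Rightarrow> (nat \<Rightarrow> 'x) \<Rightarrow> nat \<Rightarrow> 'x" where
  "append_letter i w = case_nat i w"

definition shift :: "(nat \<Rightarrow> 'x) \<Rightarrow> nat \<Rightarrow> 'x" where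
  "shift w = (\<lambda>n. w (Suc n))"

text \<open>The finite word \<open>x\<^sub>k\<dots>x\<^sub>1\<close>.\<close>

definition last_letters :: "nat \<Rightarrow> (nat \<Rightarrow> 'x) \<Rightarrow> 'x list" where
  "last_letters k w = map w (rev [0..<k])"


section \<open>Self-similar structures\<close>

text \<open>The maps \<open>F i\<close> matter only for \<open>i \<in> X\<close> and on the points of \<open>K\<close>.\<close>

definition associated_surjection ::
    "'k topology \<Rightarrow> 'x set \<Rightarrow> ('x \<Rightarrow> 'k \<Rightarrow> 'k) \<Rightarrow> ((nat \<Rightarrow> 'x) \<Rightarrow> 'k) \<Rightarrow> bool" where
  "associated_surjection K X F \<pi> \<longleftrightarrow>
     continuous_map (left_words X) K \<pi> \<and>
     \<pi> ` topspace (left_words X) = topspace K \<and>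
     (\<forall>i\<in>X. \<forall>w\<in>topspace (left_words X). F i (\<pi> w) = \<pi> (append_letter i w))"

definition self_similar_structure ::
    "'k topology \<Rightarrow> 'x set \<Rightarrow> ('x \<Rightarrow> 'k \<Rightarrow> 'k) \<Rightarrow> bool" where
  "self_similar_structure K X F \<longleftrightarrow>
     finite X \<and> compact_space K \<and> metrizable_space K \<and>
     (\<forall>i\<in>X. continuous_map K K (F i) \<and> inj_on (F i) (topspace K)) \<and>
     (\<exists>\<pi>. associated_surjection K X F \<pi>)"

definition critical_set ::
    "'k topology \<Rightarrow> 'x set \<Rightarrow> ('x \<Rightarrow> 'k \<Rightarrow> 'k) \<Rightarrow> ((nat \<Rightarrow> 'x) \<Rightarrow> 'k) \<Rightarrow> (nat \<Rightarrow> 'x) set" where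
  "critical_set K X F \<pi> =
     {w \<in> topspace (left_words X).
        \<exists>i\<in>X. \<exists>j\<in>X. i \<noteq> j \<and> \<pi> w \<in> F i ` topspace K \<inter> F j ` topspace K}"

definition post_critical_set ::
    "'k topology \<Rightarrow> 'x set \<Rightarrow> ('x \<Rightarrow> 'k \<Rightarrow> 'k) \<Rightarrow> ((nat \<Rightarrow> 'x) \<Rightarrow> 'k) \<Rightarrow> (nat \<Rightarrow> 'x) set" where
  "post_critical_set K X F \<pi> = (\<Union>n\<in>{1..}. (shift ^^ n) ` critical_set K X F \<pi>)"

definition post_critically_finite ::
    "'k topology \<Rightarrow> 'x set \<Rightarrow> ('x \<Rightarrow> 'k \<Rightarrow> 'k) \<Rightarrow> ((nat \<Rightarrow> 'x) \<Rightarrow> 'k) \<Rightarrow> bool" where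
  "post_critically_finite K X F \<pi> \<longleftrightarrow> finite (post_critical_set K X F \<pi>)"

text \<open>
  The structures enter through their associated surjections \<open>\<pi>\<^sub>1\<close>, \<open>\<pi>\<^sub>2\<close>.  The relation
  \<open>\<pi>\<^sub>2 \<circ> \<iota>\<^sub>\<rho> \<circ> \<pi>\<^sub>1\<inverse>\<close> is a well-defined homeomorphism iff it is the graph of some
  homeomorphism \<open>h\<close>.
\<close>

definition isomorphic_structures ::
    "'k topology \<Rightarrow> 'x set \<Rightarrow> ((nat \<Rightarrow> 'x) \<Rightarrow> 'k) \<Rightarrow>
     'l topology \<Rightarrow> 'y set \<Rightarrow> ((nat \<Rightarrow> 'y) \<Rightarrow> 'l) \<Rightarrow> bool" where
  "isomorphic_structures K\<^sub>1 X\<^sub>1 \<pi>\<^sub>1 K\<^sub>2 X\<^sub>2 \<pi>\<^sub>2 \<longleftrightarrow>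
     (\<exists>\<rho> h. bij_betw \<rho> X\<^sub>1 X\<^sub>2 \<and> homeomorphic_map K\<^sub>1 K\<^sub>2 h \<and>
        (\<forall>w\<in>topspace (left_words X\<^sub>1). h (\<pi>\<^sub>1 w) = \<pi>\<^sub>2 (\<rho> \<circ> w)))"


section \<open>Self-similar actions\<close>

definition tree_adjacent :: "'x list \<Rightarrow> 'x list \<Rightarrow> bool" where
  "tree_adjacent v w \<longleftrightarrow> (\<exists>x. w = v @ [x]) \<or> (\<exists>x. v = w @ [x])"

text \<open>
  Automorphisms of the rooted tree, as elements of the group \<^const>\<open>BijGroup\<close> of
  permutations of the vertex set (extensional, so equality is equality on words over \<open>X\<close>).
\<close>

definition tree_automorphisms :: "'x set \<Rightarrow> ('x list \<Rightarrow> 'x list) set" where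
  "tree_automorphisms X =
     {g \<in> Bij (lists X). g [] = [] \<and>
        (\<forall>v\<in>lists X. \<forall>w\<in>lists X. tree_adjacent (g v) (g w) \<longleftrightarrow> tree_adjacent v w)}"

definition restriction ::
    "'x set \<Rightarrow> ('x list \<Rightarrow> 'x list) \<Rightarrow> 'x list \<Rightarrow> 'x list \<Rightarrow> 'x list" where
  "restriction X g v =
     (THE h. h \<in> extensional (lists X) \<and> (\<forall>w\<in>lists X. g (v @ w) = g v @ h w))"

lemma tree_automorphism_snoc:
  assumes g: "g \<in> tree_automorphisms X" and "v \<in> lists X" "x \<in> X"
  shows "\<exists>y. g (v @ [x]) = g v @ [y]"
  using assms(2,3)
proof (induction v arbitrary: x rule: rev_induct)
  case Nil
  have root: "g [] = []" using g by (simp add: tree_automorphisms_def)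
  have "tree_adjacent [] [x]" "[] \<in> lists X" "[x] \<in> lists X"
    using Nil by (auto simp: tree_adjacent_def)
  then have "tree_adjacent (g []) (g [x])"
    using g unfolding tree_automorphisms_def by blast
  then show ?case by (simp add: root tree_adjacent_def)
next
  case (snoc y u)
  then have mem: "u \<in> lists X" "y \<in> X" "x \<in> X" by auto
  obtain z where z: "g (u @ [y]) = g u @ [z]" using snoc.IH mem by blast
  have inj: "inj_on g (lists X)"
    using g by (auto simp: tree_automorphisms_def Bij_def bij_betw_def)
  have "tree_adjacent (u @ [y]) ((u @ [y]) @ [x])"
       "u @ [y] \<in> lists X" "(u @ [y]) @ [x] \<in> lists X"
    using mem unfolding tree_adjacent_def by auto
  then have "tree_adjacent (g (u @ [y])) (g ((u @ [y]) @ [x]))"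
    using g unfolding tree_automorphisms_def by blast
  moreover have "g (u @ [y]) \<noteq> g ((u @ [y]) @ [x]) @ [t]" for t
  proof
    assume "g (u @ [y]) = g ((u @ [y]) @ [x]) @ [t]"
    then have "g ((u @ [y]) @ [x]) = g u" using z by simp
    moreover have "(u @ [y]) @ [x] \<in> lists X" using mem by auto
    ultimately have "(u @ [y]) @ [x] = u" using inj mem(1) by (blast dest: inj_onD)
    then show False by simp
  qed
  ultimately show ?case by (auto simp: tree_adjacent_def)
qed

lemma restriction_eq:
  assumes g: "g \<in> tree_automorphisms X" and v: "v \<in> lists X" and w: "w \<in> lists X"
  shows "g (v @ w) = g v @ restriction X g v w"
proof -
  have ex: "\<exists>u. g (v @ w) = g v @ u" if "w \<in> lists X" for w
    using that
  proof (induction w rule: rev_induct)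
    case (snoc x w)
    then show ?case using tree_automorphism_snoc[OF g, of "v @ w" x] v by auto
  qed simp
  define h where "h = restrict (\<lambda>w. drop (length (g v)) (g (v @ w))) (lists X)"
  have h: "h \<in> extensional (lists X) \<and> (\<forall>w\<in>lists X. g (v @ w) = g v @ h w)"
    using ex by (fastforce simp: h_def)
  have "restriction X g v = h"
    unfolding restriction_def
  proof (rule the_equality[where a = h])
    fix h' assume "h' \<in> extensional (lists X) \<and> (\<forall>w\<in>lists X. g (v @ w) = g v @ h' w)"
    then show "h' = h" using h by (intro extensionalityI[of _ "lists X"]) auto
  qed (fact h)
  then show ?thesis using h w by simp
qed

definition self_similar_action :: "'x set \<Rightarrow> ('x list \<Rightarrow> 'x list) set \<Rightarrow> bool" where
  "self_similar_action X G \<longleftrightarrow>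
     finite X \<and> subgroup G (BijGroup (lists X)) \<and> G \<subseteq> tree_automorphisms X \<and>
     (\<forall>g\<in>G. \<forall>x\<in>X. restriction X g [x] \<in> G)"

definition contracting :: "'x set \<Rightarrow> ('x list \<Rightarrow> 'x list) set \<Rightarrow> bool" where
  "contracting X G \<longleftrightarrow>
     (\<exists>N. finite N \<and> N \<subseteq> G \<and>
        (\<forall>g\<in>G. \<exists>k. \<forall>w\<in>lists X. length w \<ge> k \<longrightarrow> restriction X g w \<in> N))"


section \<open>The limit space\<close>

definition asymptotic_equivalence ::
    "'x set \<Rightarrow> ('x list \<Rightarrow> 'x list) set \<Rightarrow> ((nat \<Rightarrow> 'x) \<times> (nat \<Rightarrow> 'x)) set" where
  "asymptotic_equivalence X G =
     {(x, y). x \<in> topspace (left_words X) \<and> y \<in> topspace (left_words X) \<and>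
        (\<exists>g. g ` {1..} \<subseteq> G \<and> finite (g ` {1..}) \<and>
             (\<forall>k\<ge>1. g k (last_letters k x) = last_letters k y))}"

definition quotient_topology :: "'a topology \<Rightarrow> ('a \<Rightarrow> 'b) \<Rightarrow> 'b topology" where
  "quotient_topology T q =
     topology (\<lambda>U. U \<subseteq> q ` topspace T \<and> openin T {x \<in> topspace T. q x \<in> U})"

lemma openin_quotient_topology:
  "openin (quotient_topology T q) U \<longleftrightarrow>
     U \<subseteq> q ` topspace T \<and> openin T {x \<in> topspace T. q x \<in> U}"
proof -
  let ?L = "\<lambda>U. U \<subseteq> q ` topspace T \<and> openin T {x \<in> topspace T. q x \<in> U}"
  have "istopology ?L"
    unfolding istopology_def
  proof (intro conjI allI impI)
    fix S U assume S: "?L S" and U: "?L U"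
    then show "S \<inter> U \<subseteq> q ` topspace T" by auto
    have "{x \<in> topspace T. q x \<in> S \<inter> U} =
        {x \<in> topspace T. q x \<in> S} \<inter> {x \<in> topspace T. q x \<in> U}" by auto
    then show "openin T {x \<in> topspace T. q x \<in> S \<inter> U}" using S U by auto
  next
    fix \<K> assume K: "\<forall>U\<in>\<K>. ?L U"
    then show "\<Union>\<K> \<subseteq> q ` topspace T" by auto
    have "{x \<in> topspace T. q x \<in> \<Union>\<K>} = (\<Union>U\<in>\<K>. {x \<in> topspace T. q x \<in> U})" by auto
    then show "openin T {x \<in> topspace T. q x \<in> \<Union>\<K>}" using K by auto
  qed
  then show ?thesis by (simp add: quotient_topology_def topology_inverse')
qed

lemma quotient_map_quotient_topology: "quotient_map T (quotient_topology T q) q"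
proof -
  have "{x \<in> topspace T. q x \<in> q ` topspace T} = topspace T" by auto
  then have "openin (quotient_topology T q) (q ` topspace T)"
    by (simp add: openin_quotient_topology)
  then have "topspace (quotient_topology T q) = q ` topspace T"
    by (metis openin_quotient_topology openin_subset openin_topspace subset_antisym)
  then show ?thesis by (simp add: quotient_map_def openin_quotient_topology)
qed

definition limit_proj ::
    "'x set \<Rightarrow> ('x list \<Rightarrow> 'x list) set \<Rightarrow> (nat \<Rightarrow> 'x) \<Rightarrow> (nat \<Rightarrow> 'x) set" where
  "limit_proj X G w = asymptotic_equivalence X G `` {w}"

definition limit_space ::
    "'x set \<Rightarrow> ('x list \<Rightarrow> 'x list) set \<Rightarrow> (nat \<Rightarrow> 'x) set topology" where
  "limit_space X G = quotient_topology (left_words X) (limit_proj X G)"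

end

theory Submission
  imports Defs "HOL-Algebra.Generated_Groups"
begin

text \<open>
  Asymptotic equivalence is invariant under the shift, because an automorphism that matches two
  words also matches their prefixes. So if the limit space of some action is isomorphic to
  the given structure, words with the same image under \<open>\<pi>\<close> still have the same image after a
  shift (\<open>isomorphic_to_limit_space_imp_shift_compatible\<close>).

  Conversely, let the induced shift be well-defined. The task is to find a contracting group whose
  asymptotic equivalence is the kernel of \<open>\<pi>\<close>. Two words with the same image are then related
  letter by letter: if \<open>k\<close> is the common image of the words that remain when their
  letters \<open>x\<close> and \<open>y\<close> at some position and everything to the right are removed, then
  \<open>F x k = F y k\<close>. Letters \<open>x \<noteq> y\<close> with this property exist only if \<open>k\<close> lies in the finite set
  \<open>V\<close> of images of post-critical words. This suggests automata with the points
  of \<open>K\<close> as states, which permute such letters at the states in \<open>V\<close> and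
  do nothing elsewhere, and which go from the state \<open>k\<close> to the state \<open>F x k\<close> on reading the
  letter \<open>x\<close>. If the permutation depends only on the state, only finitely many of these automata
  act nontrivially; together with the identity they form the set \<open>nucleus\<close>, and the group is the one that it generates.

  The group is contracting since a product of two automata restricts, on long words,
  to a single one (\<open>restriction_nucleus_product\<close>). Both factors act nontrivially after a long word
  only if this word is the end of post-critical words that reach the two states. Post-critical
  words are finitely many and hence separated by their last letters; so the two
  states coincide, and automata with the same initial state compose to an automaton.

  Asymptotically equivalent words have the same image because the automata do not move points of
  \<open>K\<close> and \<open>\<pi>\<close> is continuous (\<open>equal_pi_if_asymptotic\<close>). For the converse
  (\<open>asymptotic_if_equal_pi\<close>) one needs a single permutation for each state, although the word may
  visit the same state several times. Here well-definedness of the shift enters once more: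
  fibres of \<open>\<pi>\<close> are finite, and the fibre over a recurrent state consists of one periodic word
  (\<open>recurrent_fibre_singleton\<close>), so on a repeated visit there is no freedom left.
  Finally \<open>K\<close> and the limit space are quotients of the same space by the same relation.
\<close>


section \<open>Left-infinite words\<close>

lemma mem_left_words: "w \<in> topspace (left_words X) \<longleftrightarrow> (\<forall>n. w n \<in> X)"
  by (auto simp: left_words_def PiE_UNIV_domain)

lemma funpow_shift: "(shift ^^ n) w = (\<lambda>m. w (m + n))"
  by (induction n arbitrary: w) (auto simp: shift_def funpow_swap1)

lemma append_letter_simps [simp]:
  "append_letter i w 0 = i" "append_letter i w (Suc n) = w n"
  by (auto simp: append_letter_def)

lemma append_letter_shift: "append_letter (w 0) (shift w) = w"
  by (auto simp: append_letter_def shift_def split: nat.split)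

lemma shift_append_letter [simp]: "shift (append_letter i w) = w"
  by (auto simp: shift_def)

text \<open>
  Reading a finite word from left to right and appending its letters one by one realises the
  concatenation of a left-infinite word with a finite word; \<^term>\<open>fold F v\<close> is the map of
  the space that corresponds to it.
\<close>

lemma fold_append_letter:
  "fold append_letter v u = (\<lambda>n. if n < length v then rev v ! n else u (n - length v))"
proof (induction v arbitrary: u)
  case (Cons x v)
  show ?case
  proof
    fix n
    consider "n < length v" | "n = length v" | m where "n = length v + Suc m"
      by (metis add_Suc_right less_imp_Suc_add linorder_neqE_nat)
    then show "fold append_letter (x # v) u n =
        (if n < length (x # v) then rev (x # v) ! n else u (n - length (x # v)))"
      by cases (auto simp: Cons.IH nth_append)
  qed
qed simp

lemma length_last_letters [simp]: "length (last_letters k w) = k"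
  by (simp add: last_letters_def)

lemma rev_last_letters_nth: "n < k \<Longrightarrow> rev (last_letters k w) ! n = w n"
  by (simp add: last_letters_def rev_map)

lemma last_letters_in_lists:
  "w \<in> topspace (left_words X) \<Longrightarrow> last_letters k w \<in> lists X"
  by (auto simp: last_letters_def mem_left_words)

lemma last_letters_Suc: "last_letters (Suc k) w = w k # last_letters k w"
  by (simp add: last_letters_def)

lemma last_letters_snoc: "last_letters (Suc k) w = last_letters k (shift w) @ [w 0]"
  by (induction k) (auto simp: last_letters_def shift_def)

lemma last_letters_add:
  "last_letters (m + n) w = last_letters m ((shift ^^ n) w) @ last_letters n w"
  by (induction m) (auto simp: last_letters_Suc funpow_shift, simp add: last_letters_def)

lemma fold_last_letters: "fold append_letter (last_letters n w) ((shift ^^ n) w) = w"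
  by (auto simp: fold_append_letter funpow_shift rev_last_letters_nth)

lemma shift_in_left_words:
  "w \<in> topspace (left_words X) \<Longrightarrow> shift w \<in> topspace (left_words X)"
  "w \<in> topspace (left_words X) \<Longrightarrow> (shift ^^ n) w \<in> topspace (left_words X)"
  by (auto simp: mem_left_words funpow_shift shift_def)

lemma append_letter_in_left_words:
  "i \<in> X \<Longrightarrow> w \<in> topspace (left_words X) \<Longrightarrow> append_letter i w \<in> topspace (left_words X)"
  by (auto simp: mem_left_words append_letter_def split: nat.split)

lemma fold_append_letter_in_left_words:
  "v \<in> lists X \<Longrightarrow> w \<in> topspace (left_words X) \<Longrightarrow>
    fold append_letter v w \<in> topspace (left_words X)"
  by (induction v arbitrary: w) (auto simp: append_letter_in_left_words)

lemma shift_fold_append_letter: "(shift ^^ length v) (fold append_letter v u) = u"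
  by (auto simp: fold_append_letter funpow_shift)

lemma compact_space_left_words: "finite X \<Longrightarrow> compact_space (left_words X)"
  by (simp add: left_words_def compact_space_product_topology compact_space_discrete_topology)


section \<open>Tree automorphisms and their restrictions\<close>

lemma Bij_closed: "g \<in> Bij S \<Longrightarrow> v \<in> S \<Longrightarrow> g v \<in> S"
  by (auto dest: Bij_imp_funcset)

lemma Bij_mult: "g \<in> Bij S \<Longrightarrow> h \<in> Bij S \<Longrightarrow> g \<otimes>\<^bsub>BijGroup S\<^esub> h = compose S g h"
  by (simp add: BijGroup_def)

lemma tree_automorphism_Bij: "g \<in> tree_automorphisms X \<Longrightarrow> g \<in> Bij (lists X)"
  by (simp add: tree_automorphisms_def)

lemma tree_automorphism_length:
  assumes g: "g \<in> tree_automorphisms X" and v: "v \<in> lists X"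
  shows "length (g v) = length v"
  using v
proof (induction v rule: rev_induct)
  case Nil
  then show ?case using g by (simp add: tree_automorphisms_def)
next
  case (snoc x v)
  then show ?case using tree_automorphism_snoc[OF g, of v x] by auto
qed

text \<open>
  A permutation of the words that sends children to children preserves length, so it also sends
  non-neighbours to non-neighbours: if \<open>g w\<close> is a child of \<open>g v\<close>, then the parent of \<open>w\<close>
  has the image \<open>g v\<close> and hence equals \<open>v\<close>.
\<close>

lemma tree_automorphismI:
  assumes g: "g \<in> Bij (lists X)" and root: "g [] = []"
    and snoc: "\<And>v x. v \<in> lists X \<Longrightarrow> x \<in> X \<Longrightarrow> \<exists>y. g (v @ [x]) = g v @ [y]"
  shows "g \<in> tree_automorphisms X"
proof -
  have len: "length (g v) = length v" if "v \<in> lists X" for v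
    using that
  proof (induction v rule: rev_induct)
    case (snoc x v)
    then show ?case using assms(3)[of v x] by auto
  qed (simp add: root)
  have inj: "inj_on g (lists X)" using g by (auto simp: Bij_def bij_betw_def)
  have parent: "\<exists>x. w = v @ [x]" if "v \<in> lists X" "w \<in> lists X" "g w = g v @ [y]" for v w y
  proof -
    have "length w = Suc (length v)" using len[of v] len[of w] that by simp
    then obtain w' x where w: "w = w' @ [x]" by (metis length_Suc_conv_rev)
    then have mem: "w' \<in> lists X" "x \<in> X" using that by auto
    then have "g w' = g v" using assms(3)[of w' x] that w by auto
    then show ?thesis using inj mem that w by (auto dest: inj_onD)
  qed
  have "tree_adjacent (g v) (g w) \<longleftrightarrow> tree_adjacent v w"
    if vw: "v \<in> lists X" "w \<in> lists X" for v w
  proof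
    assume "tree_adjacent (g v) (g w)"
    then show "tree_adjacent v w"
      using parent vw unfolding tree_adjacent_def by blast
  next
    assume "tree_adjacent v w"
    then obtain x where x: "w = v @ [x] \<or> v = w @ [x]" by (auto simp: tree_adjacent_def)
    then have "x \<in> X" using vw by auto
    then show "tree_adjacent (g v) (g w)"
      using x snoc[OF vw(1)] snoc[OF vw(2)] unfolding tree_adjacent_def by blast
  qed
  then show ?thesis using g root by (simp add: tree_automorphisms_def)
qed

lemma compose_tree_automorphisms:
  assumes g: "g \<in> tree_automorphisms X" and h: "h \<in> tree_automorphisms X"
  shows "compose (lists X) g h \<in> tree_automorphisms X"
proof (rule tree_automorphismI)
  note B = tree_automorphism_Bij[OF g] tree_automorphism_Bij[OF h]
  show "compose (lists X) g h \<in> Bij (lists X)" by (rule compose_Bij[OF B])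
  show "compose (lists X) g h [] = []"
    using g h by (simp add: compose_def tree_automorphisms_def)
  fix v x assume v: "v \<in> lists X" "x \<in> X"
  obtain y where y: "h (v @ [x]) = h v @ [y]" using tree_automorphism_snoc[OF h v] by blast
  have "h (v @ [x]) \<in> lists X" by (rule Bij_closed[OF B(2)]) (use v in auto)
  then have mem: "h v \<in> lists X" "y \<in> X" using y by auto
  show "\<exists>z. compose (lists X) g h (v @ [x]) = compose (lists X) g h v @ [z]"
    using tree_automorphism_snoc[OF g mem] v y by (simp add: compose_def)
qed

lemma restriction_unique:
  assumes "h \<in> extensional (lists X)" "\<And>w. w \<in> lists X \<Longrightarrow> g (v @ w) = g v @ h w"
  shows "restriction X g v = h"
  unfolding restriction_def
proof (rule the_equality)
  fix h' assume "h' \<in> extensional (lists X) \<and> (\<forall>w\<in>lists X. g (v @ w) = g v @ h' w)"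
  then show "h' = h" using assms by (intro extensionalityI[of _ "lists X"]) auto
qed (use assms in simp)

lemma restriction_extensional:
  assumes "g \<in> tree_automorphisms X" "v \<in> lists X"
  shows "restriction X g v \<in> extensional (lists X)"
proof -
  have "restriction X g v = restrict (restriction X g v) (lists X)"
    by (rule restriction_unique) (use restriction_eq[OF assms] in auto)
  then show ?thesis by (metis restrict_extensional)
qed

lemma restriction_closed:
  assumes "g \<in> tree_automorphisms X" "v \<in> lists X" "w \<in> lists X"
  shows "restriction X g v w \<in> lists X"
proof -
  have "g (v @ w) \<in> lists X"
    by (rule Bij_closed[OF tree_automorphism_Bij[OF assms(1)]]) (use assms in auto)
  then show ?thesis using restriction_eq[OF assms] by simp
qed

lemma restriction_append:
  assumes g: "g \<in> tree_automorphisms X" and v: "v \<in> lists X" and w: "w \<in> lists X"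
  shows "restriction X g (v @ w) = restriction X (restriction X g v) w"
proof (rule restriction_unique[symmetric])
  have vw: "v @ w \<in> lists X" using v w by simp
  show "restriction X g (v @ w) \<in> extensional (lists X)"
    by (rule restriction_extensional[OF g vw])
  fix u assume u: "u \<in> lists X"
  then have wu: "w @ u \<in> lists X" using w by simp
  have "g v @ restriction X g v (w @ u) = g ((v @ w) @ u)"
    using restriction_eq[OF g v wu] by simp
  also have "\<dots> = g v @ restriction X g v w @ restriction X g (v @ w) u"
    unfolding restriction_eq[OF g vw u] restriction_eq[OF g v w] by simp
  finally show "restriction X g v (w @ u) = restriction X g v w @ restriction X g (v @ w) u"
    by simp
qed

lemma restriction_compose:
  assumes g: "g \<in> tree_automorphisms X" and h: "h \<in> tree_automorphisms X"
    and v: "v \<in> lists X"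
  shows "restriction X (compose (lists X) g h) v =
    compose (lists X) (restriction X g (h v)) (restriction X h v)"
proof (rule restriction_unique)
  fix w assume w: "w \<in> lists X"
  have hv: "h v \<in> lists X" using Bij_closed[OF tree_automorphism_Bij[OF h] v] .
  show "compose (lists X) g h (v @ w) =
    compose (lists X) g h v @ compose (lists X) (restriction X g (h v)) (restriction X h v) w"
    using restriction_eq[OF h v w] restriction_eq[OF g hv restriction_closed[OF h v w]] v w
    by (simp add: compose_def)
qed simp

lemma restriction_one:
  assumes "v \<in> lists X"
  shows "restriction X (\<lambda>w\<in>lists X. w) v = (\<lambda>w\<in>lists X. w)"
  by (rule restriction_unique) (use assms in auto)


section \<open>Asymptotic equivalence\<close>

lemma asymptotic_equivalenceE:
  assumes "(x, y) \<in> asymptotic_equivalence X G"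
  obtains g where "x \<in> topspace (left_words X)" "y \<in> topspace (left_words X)"
    "\<And>k. k \<ge> 1 \<Longrightarrow> g k \<in> G" "finite (g ` {1..})"
    "\<And>k. k \<ge> 1 \<Longrightarrow> g k (last_letters k x) = last_letters k y"
  using assms unfolding asymptotic_equivalence_def by fast

text \<open>
  Finiteness of the set of values is usually known through a finite superset \<open>S\<close>, such as a
  nucleus or an image of known sets of values.
\<close>

lemma asymptotic_equivalenceI:
  assumes "x \<in> topspace (left_words X)" "y \<in> topspace (left_words X)"
    "\<And>k. k \<ge> 1 \<Longrightarrow> g k \<in> S" "finite S" "S \<subseteq> G"
    "\<And>k. k \<ge> 1 \<Longrightarrow> g k (last_letters k x) = last_letters k y"
  shows "(x, y) \<in> asymptotic_equivalence X G"
proof -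
  have "g ` {1..} \<subseteq> S" using assms(3) by auto
  then show ?thesis
    using assms finite_subset[of "g ` {1..}" S] unfolding asymptotic_equivalence_def by auto
qed

lemma equiv_asymptotic_equivalence:
  assumes G: "subgroup G (BijGroup (lists X))"
  shows "equiv (topspace (left_words X)) (asymptotic_equivalence X G)"
proof (intro equivI refl_onI symI transI)
  let ?B = "BijGroup (lists X)"
  have GB: "g \<in> Bij (lists X)" if "g \<in> G" for g
    using subgroup.mem_carrier[OF G that] by (simp add: BijGroup_def)
  show "asymptotic_equivalence X G \<subseteq> topspace (left_words X) \<times> topspace (left_words X)"
    by (auto simp: asymptotic_equivalence_def)
  show "(x, x) \<in> asymptotic_equivalence X G" if "x \<in> topspace (left_words X)" for x
    by (rule asymptotic_equivalenceI[of _ _ _ "\<lambda>_. \<one>\<^bsub>?B\<^esub>" "{\<one>\<^bsub>?B\<^esub>}"])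
      (use that subgroup.one_closed[OF G] last_letters_in_lists[OF that] in \<open>auto simp: BijGroup_def\<close>)
  fix x y assume "(x, y) \<in> asymptotic_equivalence X G"
  then obtain g where g: "x \<in> topspace (left_words X)" "y \<in> topspace (left_words X)"
    "\<And>k. k \<ge> 1 \<Longrightarrow> g k \<in> G" "finite (g ` {1..})"
    "\<And>k. k \<ge> 1 \<Longrightarrow> g k (last_letters k x) = last_letters k y"
    by (rule asymptotic_equivalenceE) blast
  have "(inv\<^bsub>?B\<^esub> (g k)) (last_letters k y) = last_letters k x" if "k \<ge> 1" for k
    using g(3)[OF that] g(5)[OF that] GB last_letters_in_lists[OF g(1), of k]
      last_letters_in_lists[OF g(2), of k]
    by (auto simp: inv_BijGroup Bij_def bij_betw_def inv_into_f_eq simp del: in_lists_conv_set)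
  then show "(y, x) \<in> asymptotic_equivalence X G"
    using g subgroup.m_inv_closed[OF G]
    by (intro asymptotic_equivalenceI[of _ _ _ "\<lambda>k. inv\<^bsub>?B\<^esub> (g k)" "(\<lambda>g. inv\<^bsub>?B\<^esub> g) ` g ` {1..}"]) auto
  fix z assume "(y, z) \<in> asymptotic_equivalence X G"
  then obtain h where h: "z \<in> topspace (left_words X)"
    "\<And>k. k \<ge> 1 \<Longrightarrow> h k \<in> G" "finite (h ` {1..})"
    "\<And>k. k \<ge> 1 \<Longrightarrow> h k (last_letters k y) = last_letters k z"
    by (rule asymptotic_equivalenceE) blast
  have "(h k \<otimes>\<^bsub>?B\<^esub> g k) (last_letters k x) = last_letters k z" if "k \<ge> 1" for k
    using g(3,5)[OF that] h(2,4)[OF that] GB last_letters_in_lists[OF g(1), of k]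
    by (simp add: Bij_mult compose_def del: in_lists_conv_set)
  then show "(x, z) \<in> asymptotic_equivalence X G"
    using g h subgroup.m_closed[OF G]
    by (intro asymptotic_equivalenceI[of _ _ _ "\<lambda>k. h k \<otimes>\<^bsub>?B\<^esub> g k"
          "(\<lambda>(h, g). h \<otimes>\<^bsub>?B\<^esub> g) ` (h ` {1..} \<times> g ` {1..})"]) auto
qed

text \<open>
  An automorphism that matches the last \<open>k + 1\<close> letters also matches their prefix of
  length \<open>k\<close>, which consists of the last \<open>k\<close> letters of the shifted words. So the
  sequence with its index moved by one witnesses the claim.
\<close>

lemma shift_asymptotic_equivalence:
  assumes G: "G \<subseteq> tree_automorphisms X" and xy: "(x, y) \<in> asymptotic_equivalence X G"
  shows "(shift x, shift y) \<in> asymptotic_equivalence X G"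
proof -
  obtain g where g: "x \<in> topspace (left_words X)" "y \<in> topspace (left_words X)"
    "\<And>k. k \<ge> 1 \<Longrightarrow> g k \<in> G" "finite (g ` {1..})"
    "\<And>k. k \<ge> 1 \<Longrightarrow> g k (last_letters k x) = last_letters k y"
    using xy by (rule asymptotic_equivalenceE) blast
  have "g (Suc k) (last_letters k (shift x)) = last_letters k (shift y)" for k
  proof -
    have "g (Suc k) \<in> tree_automorphisms X" using g(3) G by auto
    moreover have "x 0 \<in> X" using g(1) by (simp add: mem_left_words)
    ultimately obtain z where "g (Suc k) (last_letters k (shift x) @ [x 0]) =
        g (Suc k) (last_letters k (shift x)) @ [z]"
      using tree_automorphism_snoc last_letters_in_lists[OF shift_in_left_words(1)[OF g(1)]] by metis
    then show ?thesis using g(5)[of "Suc k"] by (simp add: last_letters_snoc)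
  qed
  then show ?thesis
    using g by (intro asymptotic_equivalenceI[of _ _ _ "\<lambda>k. g (Suc k)" "g ` {1..}"])
      (auto simp: shift_in_left_words)
qed


section \<open>Fibres of the associated surjection\<close>

text \<open>
  This identifies the limit space with \<open>K\<close> as soon as asymptotic equivalence is known to be
  the kernel of the associated surjection.
\<close>

lemma homeomorphic_map_of_equal_kernels:
  assumes p: "quotient_map X Y p" and q: "quotient_map X Z q"
    and ker: "\<And>x y. x \<in> topspace X \<Longrightarrow> y \<in> topspace X \<Longrightarrow> p x = p y \<longleftrightarrow> q x = q y"
  obtains h where "homeomorphic_map Y Z h" "\<And>x. x \<in> topspace X \<Longrightarrow> h (p x) = q x"
proof -
  obtain h where h: "continuous_map Y Z h" "\<And>x. x \<in> topspace X \<Longrightarrow> h (p x) = q x"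
    using quotient_map_lift_exists[OF p quotient_imp_continuous_map[OF q]] ker by metis
  obtain h' where h': "continuous_map Z Y h'" "\<And>x. x \<in> topspace X \<Longrightarrow> h' (q x) = p x"
    using quotient_map_lift_exists[OF q quotient_imp_continuous_map[OF p]] ker by metis
  have "h' (h y) = y" if "y \<in> topspace Y" for y
    using that h h' quotient_imp_surjective_map[OF p] by (metis imageE)
  moreover have "h (h' z) = z" if "z \<in> topspace Z" for z
    using that h h' quotient_imp_surjective_map[OF q] by (metis imageE)
  ultimately have "homeomorphic_maps Y Z h h'" using h h' by (simp add: homeomorphic_maps_def)
  then show thesis using that h homeomorphic_maps_map by blast
qed

locale self_similar =
  fixes K :: "'k topology" and X :: "'x set"
    and F :: "'x \<Rightarrow> 'k \<Rightarrow> 'k" and \<pi> :: "(nat \<Rightarrow> 'x) \<Rightarrow> 'k"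
  assumes struct: "self_similar_structure K X F"
    and surjection: "associated_surjection K X F \<pi>"
begin

abbreviation words where "words \<equiv> topspace (left_words X)"

definition critical where "critical = critical_set K X F \<pi>"
definition post_critical where "post_critical = post_critical_set K X F \<pi>"
text \<open>
  The image of the post-critical set is the boundary of a post-critically finite self-similar
  set, usually written \<open>V\<^sub>0\<close>: distinct cells of the same level meet only in copies of it.
\<close>

definition boundary where "boundary = \<pi> ` post_critical"

lemma finite_alphabet: "finite X"
  using struct by (simp add: self_similar_structure_def)

lemma Hausdorff: "Hausdorff_space K"
  using struct metrizable_imp_Hausdorff_space by (auto simp: self_similar_structure_def)

lemma F_closed: "i \<in> X \<Longrightarrow> k \<in> topspace K \<Longrightarrow> F i k \<in> topspace K"
  using struct by (auto simp: self_similar_structure_def dest: continuous_map_funspace)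

lemma F_inject: "i \<in> X \<Longrightarrow> k \<in> topspace K \<Longrightarrow> l \<in> topspace K \<Longrightarrow> F i k = F i l \<Longrightarrow> k = l"
  using struct by (auto simp: self_similar_structure_def dest: inj_onD)

lemma fold_F_closed: "v \<in> lists X \<Longrightarrow> k \<in> topspace K \<Longrightarrow> fold F v k \<in> topspace K"
  by (induction v arbitrary: k) (auto simp: F_closed)

lemma pi_closed: "w \<in> words \<Longrightarrow> \<pi> w \<in> topspace K"
  using surjection by (auto simp: associated_surjection_def)

lemma pi_surj: "k \<in> topspace K \<Longrightarrow> \<exists>w\<in>words. \<pi> w = k"
  using surjection unfolding associated_surjection_def by (metis imageE)

lemma pi_append: "i \<in> X \<Longrightarrow> w \<in> words \<Longrightarrow> \<pi> (append_letter i w) = F i (\<pi> w)"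
  using surjection by (simp add: associated_surjection_def)

lemma pi_fold: "v \<in> lists X \<Longrightarrow> w \<in> words \<Longrightarrow> \<pi> (fold append_letter v w) = fold F v (\<pi> w)"
  by (induction v arbitrary: w) (auto simp: pi_append append_letter_in_left_words)

lemma pi_last_letter: "w \<in> words \<Longrightarrow> \<pi> w = F (w 0) (\<pi> (shift w))"
  by (metis append_letter_shift mem_left_words pi_append shift_in_left_words(1))

lemma critical_fibre: "c \<in> critical \<Longrightarrow> w \<in> words \<Longrightarrow> \<pi> w = \<pi> c \<Longrightarrow> w \<in> critical"
  by (auto simp: critical_def critical_set_def)

lemma criticalI:
  assumes "w \<in> words" "w' \<in> words" "\<pi> w = \<pi> w'" "w 0 \<noteq> w' 0"
  shows "w \<in> critical"
proof -
  have "\<pi> w \<in> F (w 0) ` topspace K" "\<pi> w \<in> F (w' 0) ` topspace K"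
    using assms by (metis imageI pi_closed pi_last_letter shift_in_left_words(1))+
  moreover have "w 0 \<in> X" "w' 0 \<in> X" using assms by (auto simp: mem_left_words)
  ultimately show ?thesis using assms by (auto simp: critical_def critical_set_def)
qed

lemma post_critical_words: "p \<in> post_critical \<Longrightarrow> p \<in> words"
  by (auto simp: post_critical_def post_critical_set_def critical_set_def shift_in_left_words)

lemma shift_critical: "c \<in> critical \<Longrightarrow> shift c \<in> post_critical"
  unfolding post_critical_def post_critical_set_def critical_def
  by (rule UN_I[of 1]) auto

lemma shift_post_critical: "p \<in> post_critical \<Longrightarrow> (shift ^^ n) p \<in> post_critical"
  unfolding post_critical_def post_critical_set_def
proof clarsimp
  fix m c assume "m \<ge> Suc 0" "c \<in> critical_set K X F \<pi>"
  then show "\<exists>x\<in>{Suc 0..}. (shift ^^ n) ((shift ^^ m) c) \<in> (shift ^^ x) ` critical_set K X F \<pi>"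
    by (intro bexI[of _ "n + m"]) (auto simp: funpow_add)
qed

text \<open>
  Write the post-critical word as \<open>\<sigma>\<^sup>n(c)\<close> with \<open>c\<close> critical. Appending the \<open>n\<close> letters that the
  shift removed to any word of the fibre gives a word with the same image as \<open>c\<close>, and being
  critical depends only on the image.
\<close>

lemma post_critical_fibre:
  assumes "p \<in> post_critical" "w \<in> words" "\<pi> w = \<pi> p"
  shows "w \<in> post_critical"
proof -
  obtain n c where n: "n \<ge> 1" and c: "c \<in> critical" and p: "p = (shift ^^ n) c"
    using assms(1) by (auto simp: post_critical_def post_critical_set_def critical_def)
  have cw: "c \<in> words" using c by (simp add: critical_def critical_set_def)
  define v where "v = last_letters n c"
  have v: "v \<in> lists X" "length v = n" using cw by (auto simp: v_def last_letters_in_lists)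
  have "\<pi> (fold append_letter v w) = \<pi> (fold append_letter v p)"
    using v assms post_critical_words by (simp add: pi_fold)
  also have "\<dots> = \<pi> c" by (simp add: v_def p fold_last_letters)
  finally have "fold append_letter v w \<in> critical"
    using critical_fibre[OF c] fold_append_letter_in_left_words[OF v(1) assms(2)] by blast
  moreover have "w = (shift ^^ n) (fold append_letter v w)"
    using shift_fold_append_letter[of v w] v by simp
  ultimately show ?thesis
    using n unfolding post_critical_def post_critical_set_def critical_def by blast
qed

lemma mem_boundary: "w \<in> words \<Longrightarrow> \<pi> w \<in> boundary \<longleftrightarrow> w \<in> post_critical"
  using post_critical_fibre by (auto simp: boundary_def)

lemma boundary_in_K: "k \<in> boundary \<Longrightarrow> k \<in> topspace K"
  by (auto simp: boundary_def pi_closed post_critical_words)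

text \<open>
  The words over boundary points are exactly the post-critical ones, and a post-critical word stays
  post-critical when its last letters are removed. So no map \<open>F i\<close> leads into the boundary from
  outside, which makes a relabelling
  automorphism stop acting once the point that it follows has left the boundary.
\<close>

lemma boundary_backward:
  assumes "k \<in> topspace K" "v \<in> lists X" "fold F v k \<in> boundary"
  shows "k \<in> boundary"
proof -
  obtain w where w: "w \<in> words" "\<pi> w = k" using pi_surj assms by blast
  have "fold append_letter v w \<in> post_critical"
    using assms w mem_boundary fold_append_letter_in_left_words pi_fold by metis
  from shift_post_critical[OF this, of "length v"] show ?thesis
    using w mem_boundary[of w] by (simp add: shift_fold_append_letter)
qed

text \<open>
  Appending the two letters to a word over the point gives critical words, and the
  shift of a critical word is post-critical.
\<close>

lemma boundaryI:
  assumes "k \<in> topspace K" "i \<in> X" "j \<in> X" "i \<noteq> j" "F i k = F j k"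
  shows "k \<in> boundary"
proof -
  obtain w where w: "w \<in> words" "\<pi> w = k" using pi_surj assms by blast
  have "append_letter i w \<in> critical"
    by (rule criticalI[of _ "append_letter j w"])
      (use assms w in \<open>auto simp: append_letter_in_left_words pi_append\<close>)
  from shift_critical[OF this] show ?thesis using w mem_boundary[of w] by simp
qed

lemma finite_critical:
  assumes "finite post_critical"
  shows "finite critical"
proof (rule finite_subset)
  show "critical \<subseteq> (\<lambda>(i, p). append_letter i p) ` (X \<times> post_critical)"
  proof
    fix c assume c: "c \<in> critical"
    then have "c 0 \<in> X" by (auto simp: critical_def critical_set_def mem_left_words)
    then show "c \<in> (\<lambda>(i, p). append_letter i p) ` (X \<times> post_critical)"
      using shift_critical[OF c] append_letter_shift[of c] by (intro image_eqI[of _ _ "(c 0, shift c)"]) auto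
  qed
qed (use assms finite_alphabet in simp)

text \<open>
  Replacing everything but the last \<open>m\<close> letters of a word by an arbitrary word gives a
  sequence that converges to the word, so the images agree in the limit.
\<close>

lemma pi_eq_limit:
  assumes w: "w \<in> words" "w' \<in> words"
    and eq: "\<And>m. \<exists>u\<in>words. \<pi> (fold append_letter (last_letters m w) u) =
                         \<pi> (fold append_letter (last_letters m w') u)"
  shows "\<pi> w = \<pi> w'"
proof -
  obtain u where u: "\<And>m. u m \<in> words"
    and e: "\<And>m. \<pi> (fold append_letter (last_letters m w) (u m)) =
              \<pi> (fold append_letter (last_letters m w') (u m))"
    using eq by metis
  have lim: "limitin K (\<lambda>m. \<pi> (fold append_letter (last_letters m z) (u m))) (\<pi> z) sequentially"
    if z: "z \<in> words" for z
  proof -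
    have mem: "fold append_letter (last_letters m z) (u m) \<in> words" for m
      by (rule fold_append_letter_in_left_words[OF last_letters_in_lists[OF z] u])
    have "eventually (\<lambda>m. fold append_letter (last_letters m z) (u m) n = z n) sequentially" for n
      using eventually_gt_at_top[of n]
      by eventually_elim (simp add: fold_append_letter rev_last_letters_nth)
    then have "limitin (left_words X) (\<lambda>m. fold append_letter (last_letters m z) (u m)) z sequentially"
      using mem z by (auto simp: left_words_def limitin_componentwise mem_left_words
          intro!: limitin_eventually)
    then show ?thesis
      using continuous_map_limit[of "left_words X" K \<pi>] surjection
      by (simp add: associated_surjection_def o_def)
  qed
  show ?thesis
    using limitin_Hausdorff_unique[OF lim[OF w(1)] _ _ Hausdorff] lim[OF w(2)] e by simp
qed

lemma quotient_map_pi: "quotient_map (left_words X) K \<pi>"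
  using surjection Hausdorff_imp_kc_space[OF Hausdorff] compact_space_left_words[OF finite_alphabet]
  by (intro continuous_closed_imp_quotient_map continuous_imp_closed_map_gen)
    (auto simp: associated_surjection_def)

end


section \<open>Recurrent fibres\<close>

locale shift_compatible = self_similar K X F \<pi>
  for K :: "'k topology" and X :: "'x set"
    and F :: "'x \<Rightarrow> 'k \<Rightarrow> 'k" and \<pi> :: "(nat \<Rightarrow> 'x) \<Rightarrow> 'k" +
  assumes pcf: "post_critically_finite K X F \<pi>"
    and pi_shift: "w \<in> topspace (left_words X) \<Longrightarrow> w' \<in> topspace (left_words X) \<Longrightarrow>
      \<pi> w = \<pi> w' \<Longrightarrow> \<pi> (shift w) = \<pi> (shift w')"
begin

lemma finite_post_critical: "finite post_critical"
  using pcf by (simp add: post_critically_finite_def post_critical_def)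

lemma finite_boundary: "finite boundary"
  using finite_post_critical by (simp add: boundary_def)

lemma pi_funpow_shift:
  assumes "w \<in> words" "w' \<in> words" "\<pi> w = \<pi> w'"
  shows "\<pi> ((shift ^^ n) w) = \<pi> ((shift ^^ n) w')"
  proof (induction n)
  case (Suc n)
  then show ?case using pi_shift[of "(shift ^^ n) w" "(shift ^^ n) w'"] assms
    by (simp add: shift_in_left_words(2))
qed (simp add: assms)

definition fibre where "fibre k = {z \<in> words. \<pi> z = k}"

text \<open>
  Let \<open>n\<close> be the first position at which two words of the fibre differ. Removing the \<open>n\<close>
  last letters is injective on the fibre, since all its words agree there, and maps it
  into the finite critical set: the shifted words still have a common image, and none of them
  has the same last letter as all others.
\<close>

lemma finite_fibre: "finite (fibre k)"
proof (cases "\<exists>n. \<exists>z\<in>fibre k. \<exists>z'\<in>fibre k. z n \<noteq> z' n")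
  case False
  then have "\<forall>z\<in>fibre k. \<forall>z'\<in>fibre k. z = z'" by blast
  then show ?thesis by (metis finite.simps insertI1 is_singletonI' is_singleton_def)
next
  case True
  define n where "n = (LEAST n. \<exists>z\<in>fibre k. \<exists>z'\<in>fibre k. z n \<noteq> z' n)"
  have agree: "z m = z' m" if "m < n" "z \<in> fibre k" "z' \<in> fibre k" for m z z'
    using not_less_Least[of m "\<lambda>n. \<exists>z\<in>fibre k. \<exists>z'\<in>fibre k. z n \<noteq> z' n"] that n_def by blast
  obtain a b where ab: "a \<in> fibre k" "b \<in> fibre k" "a n \<noteq> b n"
    using LeastI_ex[OF True] by (auto simp: n_def)
  have inj: "inj_on (shift ^^ n) (fibre k)"
  proof (rule inj_onI, rule ext)
    fix z z' m assume z: "z \<in> fibre k" "z' \<in> fibre k" "(shift ^^ n) z = (shift ^^ n) z'"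
    show "z m = z' m"
    proof (cases "m < n")
      case False
      then show ?thesis using fun_cong[OF z(3), of "m - n"] by (simp add: funpow_shift)
    qed (use agree z in blast)
  qed
  have "(shift ^^ n) z \<in> critical" if z: "z \<in> fibre k" for z
  proof -
    obtain c where c: "c \<in> fibre k" "c n \<noteq> z n" using ab by metis
    then show ?thesis
      using z pi_funpow_shift[of z c n]
      by (intro criticalI[of _ "(shift ^^ n) c"])
        (auto simp: fibre_def shift_in_left_words, auto simp: funpow_shift)
  qed
  then have "finite ((shift ^^ n) ` fibre k)"
    by (intro finite_subset[OF _ finite_critical[OF finite_post_critical]]) blast
  then show ?thesis using inj finite_imageD by blast
qed

text \<open>
  Suppose that the images of two shifts of a word coincide, and let \<open>v\<close> be the block of letters
  between them. Appending \<open>v\<close> maps the fibre injectively to itself, hence onto itself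
  because the fibre is finite. So every word of the fibre can be written as another word of the
  fibre followed by \<open>v\<close>; repeating this shows that it is the periodic word \<open>\<dots>vvv\<close>.
\<close>

lemma recurrent_fibre_singleton:
  assumes w: "w \<in> words" and ab: "a < b"
    and rec: "\<pi> ((shift ^^ a) w) = \<pi> ((shift ^^ b) w)"
    and z: "z \<in> words" "\<pi> z = \<pi> ((shift ^^ a) w)"
  shows "z = (shift ^^ a) w"
proof -
  define u where "u = (shift ^^ a) w"
  define m where "m = b - a"
  define v where "v = last_letters m u"
  define T where "T = fold append_letter v"
  have m: "0 < m" using ab by (simp add: m_def)
  have u: "u \<in> words" using w by (simp add: u_def shift_in_left_words)
  have v: "v \<in> lists X" "length v = m" using u by (auto simp: v_def last_letters_in_lists)
  have um: "(shift ^^ m) u = (shift ^^ b) w"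
    using ab by (auto simp: u_def m_def funpow_shift add.assoc)
  have "T y \<in> fibre (\<pi> u)" if y: "y \<in> fibre (\<pi> u)" for y
  proof -
    have "\<pi> (T y) = fold F v (\<pi> ((shift ^^ m) u))"
      using y v rec um by (simp add: T_def fibre_def pi_fold u_def)
    also have "\<dots> = \<pi> (T ((shift ^^ m) u))"
      using u v by (simp add: T_def pi_fold shift_in_left_words)
    also have "T ((shift ^^ m) u) = u" by (simp add: T_def v_def fold_last_letters)
    finally show ?thesis
      using y v by (simp add: fibre_def T_def fold_append_letter_in_left_words)
  qed
  moreover have "inj_on T (fibre (\<pi> u))"
    by (rule inj_onI) (metis T_def shift_fold_append_letter)
  ultimately have onto: "T ` fibre (\<pi> u) = fibre (\<pi> u)"
    by (intro endo_inj_surj finite_fibre) auto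
  \<comment> \<open>peel off the block \<open>v\<close> until the position \<open>n\<close> lies inside it\<close>
  have "y n = y' n" if "y \<in> fibre (\<pi> u)" "y' \<in> fibre (\<pi> u)" for y y' n
    using that
  proof (induction n arbitrary: y y' rule: less_induct)
    case (less n)
    obtain x x' where x: "x \<in> fibre (\<pi> u)" "x' \<in> fibre (\<pi> u)" "y = T x" "y' = T x'"
      using less.prems onto by (metis imageE)
    show ?case
      using less.IH[of "n - m" x x'] x m v by (auto simp: T_def fold_append_letter)
  qed
  then show ?thesis using z u by (auto simp: fibre_def u_def)
qed


section \<open>Relabelling automorphisms\<close>

text \<open>
  At a point \<open>k\<close> the letters \<open>x\<close> and \<open>y\<close> with \<open>F x k = F y k\<close> may be exchanged without any
  effect on \<open>K\<close>. A local symmetry chooses such a permutation at every boundary point. It is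
  the identity at all other values, including those outside \<open>K\<close>; by finiteness of the boundary
  there are then only finitely many of them.
\<close>

definition local_symmetries :: "('k \<Rightarrow> 'x \<Rightarrow> 'x) set" where
  "local_symmetries =
     {\<phi>. \<forall>k. (k \<in> boundary \<longrightarrow> \<phi> k permutes X \<and> (\<forall>x\<in>X. F (\<phi> k x) k = F x k)) \<and>
             (k \<notin> boundary \<longrightarrow> \<phi> k = id)}"

lemma local_symmetries_permutes: "\<phi> \<in> local_symmetries \<Longrightarrow> \<phi> k permutes X"
  by (cases "k \<in> boundary") (auto simp: local_symmetries_def permutes_id)

lemma local_symmetries_F: "\<phi> \<in> local_symmetries \<Longrightarrow> x \<in> X \<Longrightarrow> F (\<phi> k x) k = F x k"
  by (cases "k \<in> boundary") (auto simp: local_symmetries_def)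

lemma local_symmetries_closed: "\<phi> \<in> local_symmetries \<Longrightarrow> \<phi> k x \<in> X \<longleftrightarrow> x \<in> X"
  by (rule permutes_in_image[OF local_symmetries_permutes])

lemma finite_local_symmetries: "finite local_symmetries"
proof (rule finite_subset)
  show "local_symmetries \<subseteq> {\<phi>. \<forall>k. (k \<in> boundary \<longrightarrow> \<phi> k \<in> {p. p permutes X}) \<and>
      (k \<notin> boundary \<longrightarrow> \<phi> k = id)}"
    by (auto simp: local_symmetries_def)
qed (intro finite_set_of_finite_funs finite_boundary finite_permutations finite_alphabet)

lemma id_local_symmetry: "(\<lambda>_. id) \<in> local_symmetries"
  by (simp add: local_symmetries_def permutes_id)

lemma compose_local_symmetry:
  "\<phi> \<in> local_symmetries \<Longrightarrow> \<psi> \<in> local_symmetries \<Longrightarrow> (\<lambda>k. \<phi> k \<circ> \<psi> k) \<in> local_symmetries"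
  unfolding local_symmetries_def by (auto simp: permutes_compose permutes_in_image)

lemma inv_local_symmetry:
  assumes "\<phi> \<in> local_symmetries"
  shows "(\<lambda>k. inv_into UNIV (\<phi> k)) \<in> local_symmetries"
proof -
  have "F (inv_into UNIV (\<phi> k) x) k = F x k" if "x \<in> X" for k x
    using local_symmetries_F[OF assms, of "inv_into UNIV (\<phi> k) x" k] that
      permutes_inverses(1)[OF local_symmetries_permutes[OF assms]]
      permutes_in_image[OF permutes_inv[OF local_symmetries_permutes[OF assms]]]
    by simp
  then show ?thesis
    using assms unfolding local_symmetries_def by (auto intro: permutes_inv)
qed

text \<open>
  This is an automaton whose states are the points of \<open>K\<close>: in the state \<open>k\<close>, the point
  to which the letters read so far have moved the initial one, it permutes the next letter
  by \<open>\<phi> k\<close> and moves to the state \<open>F x k\<close>. For a local symmetry the relabelled letter leads to the same state, so the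
  state is determined by the output as well as by the input.
\<close>

primrec relabel :: "('k \<Rightarrow> 'x \<Rightarrow> 'x) \<Rightarrow> 'k \<Rightarrow> 'x list \<Rightarrow> 'x list" where
  "relabel \<phi> k [] = []"
| "relabel \<phi> k (x # v) = \<phi> k x # relabel \<phi> (F x k) v"

lemma length_relabel [simp]: "length (relabel \<phi> k v) = length v"
  by (induction v arbitrary: k) auto

lemma relabel_closed: "\<phi> \<in> local_symmetries \<Longrightarrow> v \<in> lists X \<Longrightarrow> relabel \<phi> k v \<in> lists X"
  by (induction v arbitrary: k) (auto simp: local_symmetries_closed)

lemma fold_F_relabel:
  "\<phi> \<in> local_symmetries \<Longrightarrow> v \<in> lists X \<Longrightarrow> fold F (relabel \<phi> k v) k = fold F v k"
  by (induction v arbitrary: k) (auto simp: local_symmetries_F)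

lemma relabel_append: "relabel \<phi> k (v @ w) = relabel \<phi> k v @ relabel \<phi> (fold F v k) w"
  by (induction v arbitrary: k) auto

text \<open>
  Both automata pass through the same states, so relabellings with the same initial state compose
  state by state.
\<close>

lemma relabel_compose:
  "\<psi> \<in> local_symmetries \<Longrightarrow> v \<in> lists X \<Longrightarrow>
    relabel \<phi> k (relabel \<psi> k v) = relabel (\<lambda>k. \<phi> k \<circ> \<psi> k) k v"
  by (induction v arbitrary: k) (auto simp: local_symmetries_F)

lemma relabel_id: "relabel (\<lambda>_. id) k v = v"
  by (induction v arbitrary: k) auto

lemma relabel_inv:
  assumes "\<phi> \<in> local_symmetries" "v \<in> lists X"
  shows "relabel (\<lambda>k. inv_into UNIV (\<phi> k)) k (relabel \<phi> k v) = v"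
  using assms by (simp add: relabel_compose permutes_inv_o(2)[OF local_symmetries_permutes] relabel_id)

lemma relabel_inv':
  assumes "\<phi> \<in> local_symmetries" "v \<in> lists X"
  shows "relabel \<phi> k (relabel (\<lambda>k. inv_into UNIV (\<phi> k)) k v) = v"
  using assms by (simp add: relabel_compose inv_local_symmetry
      permutes_inv_o(1)[OF local_symmetries_permutes] relabel_id)

lemma relabel_off_boundary:
  assumes "\<phi> \<in> local_symmetries"
  shows "k \<in> topspace K \<Longrightarrow> k \<notin> boundary \<Longrightarrow> v \<in> lists X \<Longrightarrow> relabel \<phi> k v = v"
proof (induction v arbitrary: k)
  case (Cons x v)
  have "F x k \<notin> boundary" using boundary_backward[of k "[x]"] Cons.prems by auto
  moreover have "\<phi> k = id" using assms Cons.prems by (simp add: local_symmetries_def)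
  ultimately show ?case using Cons F_closed by auto
qed simp

definition relabelling :: "('k \<Rightarrow> 'x \<Rightarrow> 'x) \<Rightarrow> 'k \<Rightarrow> 'x list \<Rightarrow> 'x list" where
  "relabelling \<phi> k = restrict (relabel \<phi> k) (lists X)"

lemma relabelling_apply [simp]: "v \<in> lists X \<Longrightarrow> relabelling \<phi> k v = relabel \<phi> k v"
  by (simp add: relabelling_def)

lemma relabelling_tree_automorphism:
  assumes "\<phi> \<in> local_symmetries"
  shows "relabelling \<phi> k \<in> tree_automorphisms X"
proof (rule tree_automorphismI)
  have "bij_betw (relabelling \<phi> k) (lists X) (lists X)"
    by (rule bij_betw_byWitness[where f' = "relabel (\<lambda>k. inv_into UNIV (\<phi> k)) k"])
      (use assms in \<open>simp_all add: relabel_inv relabel_inv' inv_local_symmetry relabel_closed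
        image_subset_iff del: in_lists_conv_set\<close>)
  then show "relabelling \<phi> k \<in> Bij (lists X)" by (simp add: Bij_def relabelling_def)
qed (auto simp: relabel_append)

lemma relabelling_compose:
  assumes "\<phi> \<in> local_symmetries" "\<psi> \<in> local_symmetries"
  shows "compose (lists X) (relabelling \<phi> k) (relabelling \<psi> k) = relabelling (\<lambda>k. \<phi> k \<circ> \<psi> k) k"
  using assms relabel_closed
  by (auto simp: compose_def relabelling_def relabel_compose simp del: in_lists_conv_set intro!: restrict_ext)

lemma relabelling_id: "relabelling (\<lambda>_. id) k = (\<lambda>v\<in>lists X. v)"
  by (rule ext) (simp add: relabelling_def relabel_id restrict_def)

lemma relabelling_off_boundary:
  assumes "\<phi> \<in> local_symmetries" "k \<in> topspace K" "k \<notin> boundary"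
  shows "relabelling \<phi> k = (\<lambda>v\<in>lists X. v)"
  unfolding relabelling_def by (intro restrict_ext relabel_off_boundary assms)

lemma restriction_relabelling:
  assumes "v \<in> lists X"
  shows "restriction X (relabelling \<phi> k) v = relabelling \<phi> (fold F v k)"
  by (rule restriction_unique) (use assms in \<open>auto simp: relabel_append relabelling_def simp del: in_lists_conv_set\<close>)

text \<open>
  The identity is added separately for the case of an empty boundary. Relabellings with an initial
  state in \<open>K\<close> off the boundary are the identity, so they are covered, too.
\<close>

definition nucleus where
  "nucleus = insert (\<lambda>v\<in>lists X. v) ((\<lambda>(\<phi>, k). relabelling \<phi> k) ` (local_symmetries \<times> boundary))"

lemma finite_nucleus: "finite nucleus"
  by (simp add: nucleus_def finite_local_symmetries finite_boundary)

lemma one_in_nucleus: "(\<lambda>v\<in>lists X. v) \<in> nucleus"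
  by (simp add: nucleus_def)

lemma relabelling_in_nucleus:
  "\<phi> \<in> local_symmetries \<Longrightarrow> k \<in> topspace K \<Longrightarrow> relabelling \<phi> k \<in> nucleus"
  using relabelling_off_boundary by (cases "k \<in> boundary") (auto simp: nucleus_def)

lemma nucleus_cases:
  assumes "g \<in> nucleus"
  obtains (one) "g = (\<lambda>v\<in>lists X. v)"
  | (relabelling) \<phi> k where "\<phi> \<in> local_symmetries" "k \<in> boundary" "g = relabelling \<phi> k"
  using assms by (auto simp: nucleus_def)

lemma nucleus_tree_automorphism: "g \<in> nucleus \<Longrightarrow> g \<in> tree_automorphisms X"
  using relabelling_tree_automorphism[OF id_local_symmetry] relabelling_tree_automorphism
  by (auto simp: relabelling_id elim!: nucleus_cases)

lemma restriction_nucleus: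
  assumes "g \<in> nucleus" "v \<in> lists X"
  shows "restriction X g v \<in> nucleus"
  using assms(1)
proof (cases rule: nucleus_cases)
  case (relabelling \<phi> k)
  then show ?thesis
    using assms(2) relabelling_in_nucleus fold_F_closed boundary_in_K
    by (auto simp: restriction_relabelling simp del: in_lists_conv_set)
qed (simp add: restriction_one assms one_in_nucleus)

lemma inv_nucleus:
  assumes "g \<in> nucleus"
  shows "inv\<^bsub>BijGroup (lists X)\<^esub> g \<in> nucleus"
  using assms
proof (cases rule: nucleus_cases)
  case one
  then show ?thesis
    using monoid.inv_one[OF group.is_monoid[OF group_BijGroup[of "lists X"]]] one_in_nucleus by (simp add: BijGroup_def)
next
  case (relabelling \<phi> k)
  let ?h = "relabelling (\<lambda>k. inv_into UNIV (\<phi> k)) k"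
  have B: "?h \<in> Bij (lists X)" "g \<in> Bij (lists X)"
    by (auto simp: relabelling inv_local_symmetry
        intro!: tree_automorphism_Bij relabelling_tree_automorphism)
  have "(\<lambda>k. inv_into UNIV (\<phi> k) \<circ> \<phi> k) = (\<lambda>_. id)"
    using permutes_inv_o(2)[OF local_symmetries_permutes] relabelling by auto
  then have "?h \<otimes>\<^bsub>BijGroup (lists X)\<^esub> g = \<one>\<^bsub>BijGroup (lists X)\<^esub>"
    using relabelling relabelling_compose[OF inv_local_symmetry, of \<phi> \<phi> k] B
    by (simp add: Bij_mult relabelling_id) (simp add: BijGroup_def)
  then have "inv\<^bsub>BijGroup (lists X)\<^esub> g = ?h"
    using B by (intro group.inv_equality[OF group_BijGroup]) (auto simp: BijGroup_def)
  then show ?thesis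
    using relabelling inv_local_symmetry relabelling_in_nucleus boundary_in_K by simp
qed

lemma post_critical_separated:
  obtains n where "\<And>p q. p \<in> post_critical \<Longrightarrow> q \<in> post_critical \<Longrightarrow>
    (\<And>i. i < n \<Longrightarrow> p i = q i) \<Longrightarrow> p = q"
proof -
  \<comment> \<open>\<open>d (p, q)\<close> is the first position at which the words differ\<close>
  define d where "d = (\<lambda>(p, q :: nat \<Rightarrow> 'x). LEAST i. p i \<noteq> q i)"
  define n where "n = Suc (Max (insert 0 (d ` (post_critical \<times> post_critical))))"
  have fin: "finite (d ` (post_critical \<times> post_critical))" by (simp add: finite_post_critical)
  show thesis
  proof (rule that[of n], rule ccontr)
    fix p q assume pq: "p \<in> post_critical" "q \<in> post_critical"
      and agree: "\<And>i. i < n \<Longrightarrow> p i = q i" and "p \<noteq> q"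
    then have "\<exists>i. p i \<noteq> q i" by blast
    then have "p (d (p, q)) \<noteq> q (d (p, q))" unfolding d_def by (simp only: prod.case) (rule LeastI_ex)
    moreover have "d (p, q) < n"
      using pq fin by (auto simp: n_def less_Suc_eq_le intro!: Max_ge)
    ultimately show False using agree by blast
  qed
qed

text \<open>
  The points are images of post-critical words that, after \<open>v\<close> is appended, are still
  post-critical. The extended words agree in their last \<open>n\<close> letters, so they coincide, and
  so do the words before the extension.
\<close>

lemma boundary_backward_unique:
  assumes sep: "\<And>p q. p \<in> post_critical \<Longrightarrow> q \<in> post_critical \<Longrightarrow>
      (\<And>i. i < n \<Longrightarrow> p i = q i) \<Longrightarrow> p = q"
    and v: "v \<in> lists X" "n \<le> length v"
    and k: "k \<in> boundary" "fold F v k \<in> boundary" and l: "l \<in> boundary" "fold F v l \<in> boundary"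
  shows "k = l"
proof -
  obtain p q where p: "p \<in> words" "\<pi> p = k" and q: "q \<in> words" "\<pi> q = l"
    using pi_surj boundary_in_K k l by metis
  let ?p = "fold append_letter v p" and ?q = "fold append_letter v q"
  have "?p \<in> words" "?q \<in> words" using p q v by (auto intro!: fold_append_letter_in_left_words)
  moreover have "\<pi> ?p = fold F v k" "\<pi> ?q = fold F v l" using p q v by (auto simp: pi_fold)
  ultimately have "?p \<in> post_critical" "?q \<in> post_critical" using k l mem_boundary by metis+
  then have "?p = ?q" by (rule sep) (use v in \<open>auto simp: fold_append_letter\<close>)
  then show ?thesis using p q by (metis shift_fold_append_letter)
qed

text \<open>
  The restriction of a relabelling to a long word is trivial unless the state reached is in
  the boundary. Suppose that the states reached by \<open>h\<close> on \<open>v\<close> and by \<open>g\<close> on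
  \<open>h v\<close> are both boundary points. The state that
  \<open>h\<close> reaches on \<open>v\<close> is also the one to which \<open>h v\<close> leads, so by
  \<open>boundary_backward_unique\<close> the two initial states are equal. Then the product is
  a relabelling again. In the other cases one factor restricts to the identity.
\<close>

lemma restriction_nucleus_product:
  obtains n where "\<And>g h v. g \<in> nucleus \<Longrightarrow> h \<in> nucleus \<Longrightarrow> v \<in> lists X \<Longrightarrow> n \<le> length v \<Longrightarrow>
    restriction X (compose (lists X) g h) v \<in> nucleus"
proof -
  obtain n where sep: "\<And>p q. p \<in> post_critical \<Longrightarrow> q \<in> post_critical \<Longrightarrow>
      (\<And>i. i < n \<Longrightarrow> p i = q i) \<Longrightarrow> p = q"
    by (rule post_critical_separated) blast
  have "restriction X (compose (lists X) g h) v \<in> nucleus"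
    if g: "g \<in> nucleus" and h: "h \<in> nucleus" and v: "v \<in> lists X" "n \<le> length v" for g h v
  proof -
    note ta = nucleus_tree_automorphism[OF g] nucleus_tree_automorphism[OF h]
    have hv: "h v \<in> lists X" using Bij_closed[OF tree_automorphism_Bij[OF ta(2)] v(1)] .
    have eq: "restriction X (compose (lists X) g h) v =
        compose (lists X) (restriction X g (h v)) (restriction X h v)"
      by (rule restriction_compose[OF ta v(1)])
    have ext: "restriction X g (h v) \<in> extensional (lists X)"
      "restriction X h v \<in> extensional (lists X)"
      using restriction_extensional ta hv v by auto
    have R: "restriction X g (h v) \<in> nucleus" "restriction X h v \<in> nucleus"
      using restriction_nucleus g h hv v by auto
    have funcset: "restriction X h v \<in> lists X \<rightarrow> lists X"
      "restriction X g (h v) \<in> lists X \<rightarrow> lists X"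
      using restriction_closed[OF ta(2) v(1)] restriction_closed[OF ta(1) hv] by blast+
    show ?thesis
    proof (cases "restriction X g (h v) = (\<lambda>v\<in>lists X. v) \<or> restriction X h v = (\<lambda>v\<in>lists X. v)")
      case True
      then show ?thesis using eq R Id_compose[OF funcset(1) ext(2)] compose_Id[OF funcset(2) ext(1)] by auto
    next
      case False
      then have nontrivial: "g \<noteq> (\<lambda>v\<in>lists X. v)" "h \<noteq> (\<lambda>v\<in>lists X. v)"
        using restriction_one[OF v(1)] restriction_one[OF hv] by metis+
      obtain \<phi> k where \<phi>: "\<phi> \<in> local_symmetries" "k \<in> boundary" "g = relabelling \<phi> k"
        using g nontrivial by (auto elim: nucleus_cases)
      obtain \<psi> l where \<psi>: "\<psi> \<in> local_symmetries" "l \<in> boundary" "h = relabelling \<psi> l"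
        using h nontrivial by (auto elim: nucleus_cases)
      have rg: "restriction X g (h v) = relabelling \<phi> (fold F (h v) k)"
        and rh: "restriction X h v = relabelling \<psi> (fold F v l)"
        using \<phi> \<psi> hv v by (auto simp: restriction_relabelling simp del: in_lists_conv_set)
      have hl: "fold F (h v) l = fold F v l" using \<psi> v by (simp add: fold_F_relabel)
      have "fold F (h v) k \<in> boundary" "fold F v l \<in> boundary"
        using False rg rh relabelling_off_boundary fold_F_closed boundary_in_K \<phi> \<psi> v hv by metis+
      moreover have "n \<le> length (h v)" using \<psi> v by simp
      ultimately have "k = l"
        using \<phi> \<psi> hl by (intro boundary_backward_unique[OF sep, of n "h v" k l] hv) auto
      then show ?thesis
        using eq rg rh hl relabelling_compose[OF \<phi>(1) \<psi>(1)]
          relabelling_in_nucleus[OF compose_local_symmetry[OF \<phi>(1) \<psi>(1)]]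
          fold_F_closed[OF v(1)] boundary_in_K \<psi> by simp
    qed
  qed
  then show thesis by (rule that)
qed


section \<open>The group generated by the nucleus\<close>


definition nucleus_group where
  "nucleus_group = generate (BijGroup (lists X)) nucleus"

lemma nucleus_carrier: "nucleus \<subseteq> carrier (BijGroup (lists X))"
  using nucleus_tree_automorphism tree_automorphism_Bij by (auto simp: BijGroup_def)

lemma subgroup_nucleus_group: "subgroup nucleus_group (BijGroup (lists X))"
  unfolding nucleus_group_def by (rule group.generate_is_subgroup[OF group_BijGroup nucleus_carrier])

lemma nucleus_subset_group: "nucleus \<subseteq> nucleus_group"
  by (auto simp: nucleus_group_def intro: generate.incl)

text \<open>
  The nucleus contains the identity and is closed under inverses, so every element of the group is
  a product of elements of the nucleus.
\<close>

lemma nucleus_group_induct [consumes 1, case_names nucleus compose]: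
  assumes "g \<in> nucleus_group"
    and "\<And>g. g \<in> nucleus \<Longrightarrow> P g"
    and "\<And>g h. g \<in> nucleus_group \<Longrightarrow> h \<in> nucleus_group \<Longrightarrow> P g \<Longrightarrow> P h \<Longrightarrow> P (compose (lists X) g h)"
  shows "P g"
  using assms(1) unfolding nucleus_group_def
proof (induction rule: generate.induct)
  case one
  have "\<one>\<^bsub>BijGroup (lists X)\<^esub> = (\<lambda>v\<in>lists X. v)" by (simp add: BijGroup_def)
  then show ?case using assms(2)[OF one_in_nucleus] by (simp only:)
next
  case (eng g h)
  then have "g \<in> nucleus_group" "h \<in> nucleus_group" by (auto simp: nucleus_group_def)
  moreover have "g \<otimes>\<^bsub>BijGroup (lists X)\<^esub> h = compose (lists X) g h"
    using group.generate_in_carrier[OF group_BijGroup nucleus_carrier eng(1)]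
      group.generate_in_carrier[OF group_BijGroup nucleus_carrier eng(2)]
    by (simp add: BijGroup_def)
  ultimately show ?case using assms(3)[of g h] eng.IH by (simp only:)
qed (use assms(2) inv_nucleus in auto)

lemma nucleus_group_tree_automorphism:
  "g \<in> nucleus_group \<Longrightarrow> g \<in> tree_automorphisms X"
  by (induction rule: nucleus_group_induct)
    (auto simp: nucleus_tree_automorphism compose_tree_automorphisms)

lemma nucleus_group_compose:
  assumes "g \<in> nucleus_group" "h \<in> nucleus_group"
  shows "compose (lists X) g h \<in> nucleus_group"
  using subgroup.m_closed[OF subgroup_nucleus_group assms] assms
    Bij_mult[of g "lists X" h] nucleus_group_tree_automorphism tree_automorphism_Bij by metis

lemma restriction_nucleus_group:
  assumes "g \<in> nucleus_group" "v \<in> lists X"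
  shows "restriction X g v \<in> nucleus_group"
  using assms
proof (induction arbitrary: v rule: nucleus_group_induct)
  case (nucleus g)
  then show ?case using restriction_nucleus nucleus_subset_group by blast
next
  case (compose g h)
  note ta = compose.hyps[THEN nucleus_group_tree_automorphism]
  have "h v \<in> lists X"
    using Bij_closed[OF tree_automorphism_Bij[OF ta(2)] compose.prems] .
  then show ?case
    using compose restriction_compose[OF ta compose.prems] nucleus_group_compose by simp
qed

lemma self_similar_action_nucleus_group: "self_similar_action X nucleus_group"
  unfolding self_similar_action_def
  using finite_alphabet subgroup_nucleus_group nucleus_group_tree_automorphism restriction_nucleus_group
  by auto

text \<open>
  A word that is long enough for both factors to restrict into the nucleus has to be extended
  only by the bounded number of letters after which a product of two elements of the nucleus
  restricts into the nucleus.
\<close>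

lemma eventually_in_nucleus:
  assumes "g \<in> nucleus_group"
  shows "\<exists>k. \<forall>v\<in>lists X. k \<le> length v \<longrightarrow> restriction X g v \<in> nucleus"
  using assms
proof (induction rule: nucleus_group_induct)
  case (nucleus g)
  then show ?case using restriction_nucleus by blast
next
  case (compose g h)
  note ta = compose.hyps[THEN nucleus_group_tree_automorphism]
  obtain n where n: "\<And>g h v. g \<in> nucleus \<Longrightarrow> h \<in> nucleus \<Longrightarrow> v \<in> lists X \<Longrightarrow> n \<le> length v \<Longrightarrow>
      restriction X (compose (lists X) g h) v \<in> nucleus"
    by (rule restriction_nucleus_product) blast
  obtain a b where
    a: "\<And>v. v \<in> lists X \<Longrightarrow> a \<le> length v \<Longrightarrow> restriction X g v \<in> nucleus" and
    b: "\<And>v. v \<in> lists X \<Longrightarrow> b \<le> length v \<Longrightarrow> restriction X h v \<in> nucleus"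
    using compose.IH by blast
  have "restriction X (compose (lists X) g h) v \<in> nucleus"
    if v: "v \<in> lists X" and len: "max a b + n \<le> length v" for v
  proof -
    define t u where "t = take (max a b) v" and "u = drop (max a b) v"
    have tu: "v = t @ u" "t \<in> lists X" "u \<in> lists X" "length t = max a b" "n \<le> length u"
      using v len by (auto simp: t_def u_def dest: in_set_takeD in_set_dropD)
    have ht: "h t \<in> lists X" "length (h t) = length t"
      using Bij_closed[OF tree_automorphism_Bij[OF ta(2)] tu(2)]
        tree_automorphism_length[OF ta(2) tu(2)] by auto
    have "restriction X g (h t) \<in> nucleus" "restriction X h t \<in> nucleus"
      using a b ht tu by auto
    then show ?thesis
      using n tu restriction_append[OF compose_tree_automorphisms[OF ta], of t u]
        restriction_compose[OF ta, of t] by simp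
  qed
  then show ?case by blast
qed

lemma contracting_nucleus_group: "contracting X nucleus_group"
  unfolding contracting_def
  using finite_nucleus nucleus_subset_group eventually_in_nucleus by blast

text \<open>
  Let \<open>w\<close> and \<open>w'\<close> have the same image, and let \<open>k n\<close> be the common image of the words that
  remain when the letters at the positions \<open>0, \<dots>, n\<close> are removed. The letters at position
  \<open>n\<close> lead from \<open>k n\<close> to the same point, so a local symmetry may exchange them. One and the same
  local symmetry \<open>\<phi>\<close> can be used at all positions: when a state recurs, \<open>k i = k j\<close> with
  \<open>i < j\<close>, the fibre over \<open>F (w j) (k j)\<close> is a single word, so the letter at position \<open>j\<close> is not
  equivalent to any other letter. Hence each state needs at most one transposition, the one for
  the smallest position at which it occurs. The relabellings by \<open>\<phi>\<close> with the
  states \<open>k n\<close> then carry the letters of \<open>w\<close> to those of \<open>w'\<close>.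
\<close>

lemma asymptotic_if_equal_pi:
  assumes w: "w \<in> words" "w' \<in> words" and eq: "\<pi> w = \<pi> w'"
  shows "(w, w') \<in> asymptotic_equivalence X nucleus_group"
proof -
  define k where "k n = \<pi> ((shift ^^ Suc n) w)" for n
  have letters: "w n \<in> X" "w' n \<in> X" for n using w by (auto simp: mem_left_words)
  have k: "k n \<in> topspace K" for n
    unfolding k_def by (intro pi_closed shift_in_left_words(2) w)
  have step: "F (w n) (k n) = \<pi> ((shift ^^ n) w)" "F (w' n) (k n) = \<pi> ((shift ^^ n) w)" for n
  proof -
    have "\<pi> ((shift ^^ n) z) = F (z n) (\<pi> ((shift ^^ Suc n) z))" if "z \<in> words" for z
      using pi_last_letter[OF shift_in_left_words(2)[OF that, of n]] by (simp add: funpow_shift)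
    then show "F (w n) (k n) = \<pi> ((shift ^^ n) w)" "F (w' n) (k n) = \<pi> ((shift ^^ n) w)"
      using w eq pi_funpow_shift[OF w eq] unfolding k_def by metis+
  qed
  have rigid: "x = w j" if ij: "i < j" "k i = k j" and x: "x \<in> X" "F x (k j) = F (w j) (k j)" for i j x
  proof -
    have "\<pi> ((shift ^^ (j - i - 1)) ((shift ^^ Suc i) w)) =
        \<pi> ((shift ^^ (j - i - 1)) ((shift ^^ Suc j) w))"
      using ij w unfolding k_def by (intro pi_funpow_shift shift_in_left_words(2))
    moreover have "(shift ^^ (j - i - 1)) ((shift ^^ Suc i) w) = (shift ^^ j) w"
      "(shift ^^ (j - i - 1)) ((shift ^^ Suc j) w) = (shift ^^ (j + (j - i))) w"
      using ij by (auto simp del: funpow.simps simp: funpow_shift intro!: ext arg_cong[of _ _ w])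
    ultimately have rec: "\<pi> ((shift ^^ j) w) = \<pi> ((shift ^^ (j + (j - i))) w)" by simp
    \<comment> \<open>the fibre over the image of the \<open>j\<close>-th shift is a singleton, since this image recurs
        after another \<open>j - i\<close> shifts\<close>
    have "append_letter x ((shift ^^ Suc j) w) = (shift ^^ j) w"
    proof (rule recurrent_fibre_singleton[OF w(1) _ rec])
      show "append_letter x ((shift ^^ Suc j) w) \<in> words"
        by (intro append_letter_in_left_words x shift_in_left_words w)
      show "\<pi> (append_letter x ((shift ^^ Suc j) w)) = \<pi> ((shift ^^ j) w)"
        using x step(1)[of j] pi_append[OF x(1) shift_in_left_words(2)[OF w(1)], of "Suc j"]
        unfolding k_def by simp
    qed (use ij in simp)
    from fun_cong[OF this, of 0] show ?thesis by (simp add: funpow_shift)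
  qed
  define N where "N c = (LEAST n. k n = c)" for c
  have N: "k (N (k n)) = k n" "N (k n) \<le> n" for n
    unfolding N_def by (rule LeastI[of _ n], simp) (rule Least_le, simp)
  define \<phi> where "\<phi> c = (if c \<in> range k then Transposition.transpose (w (N c)) (w' (N c)) else id)" for c
  have "\<phi> c permutes X \<and> (\<forall>x\<in>X. F (\<phi> c x) c = F x c)" for c
  proof (cases "c \<in> range k")
    case True
    then have "k (N c) = c" using N by auto
    then have "F (w (N c)) c = F (w' (N c)) c" using step[of "N c"] by simp
    then show ?thesis
      using True letters by (auto simp: \<phi>_def Transposition.transpose_def permutes_swap_id)
  qed (simp add: \<phi>_def permutes_id)
  moreover have "\<phi> c = id" if c: "c \<notin> boundary" for c
  proof (cases "c \<in> range k")
    case True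
    then have "k (N c) = c" using N by auto
    then have "w (N c) = w' (N c)"
      using boundaryI[OF k letters, of "N c" "N c" "N c"] step[of "N c"] c by auto
    then show ?thesis by (simp add: \<phi>_def)
  qed (simp add: \<phi>_def)
  ultimately have \<phi>: "\<phi> \<in> local_symmetries" by (simp add: local_symmetries_def)
  have moves: "\<phi> (k n) (w n) = w' n" for n
  proof (cases "N (k n) = n")
    case True
    then show ?thesis by (simp add: \<phi>_def)
  next
    case False
    then have less: "N (k n) < n" using N(2)[of n] by simp
    have fixed: "x = w n" if "x \<in> X" "F x (k n) = F (w n) (k n)" for x
      using rigid[OF less N(1) that] .
    have "w' n = w n" using fixed[OF letters(2)] step[of n] by simp
    moreover have "w (N (k n)) = w n \<longleftrightarrow> w' (N (k n)) = w n"
    proof -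
      have "F (w (N (k n))) (k n) = F (w' (N (k n))) (k n)"
        using step[of "N (k n)"] unfolding N(1) by simp
      then show ?thesis
        using fixed[OF letters(1), of "N (k n)"] fixed[OF letters(2), of "N (k n)"] by auto
    qed
    moreover have "\<phi> (k n) = Transposition.transpose (w (N (k n))) (w' (N (k n)))"
      by (simp add: \<phi>_def)
    ultimately show ?thesis by (cases "w (N (k n)) = w n") (auto simp: Transposition.transpose_def)
  qed
  have "relabel \<phi> (\<pi> ((shift ^^ m) w)) (last_letters m w) = last_letters m w'" for m
  proof (induction m)
    case (Suc m)
    then show ?case
      using moves[of m] step(1)[of m] unfolding k_def last_letters_Suc by simp
  qed (simp add: last_letters_def)
  then show ?thesis
    using w \<phi> finite_nucleus nucleus_subset_group last_letters_in_lists[OF w(1)]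
    by (intro asymptotic_equivalenceI[of _ _ _ "\<lambda>m. relabelling \<phi> (\<pi> ((shift ^^ m) w))" nucleus])
      (auto intro!: relabelling_in_nucleus pi_closed shift_in_left_words(2) simp del: in_lists_conv_set)
qed

text \<open>
  Restricting the finitely many automorphisms to sufficiently many initial letters
  gives elements of the nucleus that match the last \<open>m\<close> letters of the two words. A relabelling with
  initial state \<open>\<pi> u\<close> does not change the image of the word \<open>u\<close> followed by these letters, and
  letting \<open>m\<close> grow proves equality of the images.
\<close>

lemma equal_pi_if_asymptotic:
  assumes "(w, w') \<in> asymptotic_equivalence X nucleus_group"
  shows "\<pi> w = \<pi> w'"
proof -
  obtain g where w: "w \<in> words" "w' \<in> words" and g: "\<And>k. k \<ge> 1 \<Longrightarrow> g k \<in> nucleus_group"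
    and fin: "finite (g ` {1..})"
    and maps: "\<And>k. k \<ge> 1 \<Longrightarrow> g k (last_letters k w) = last_letters k w'"
    using assms by (rule asymptotic_equivalenceE) blast
  obtain \<kappa> where \<kappa>: "\<And>g v. g \<in> nucleus_group \<Longrightarrow> v \<in> lists X \<Longrightarrow> \<kappa> g \<le> length v \<Longrightarrow>
      restriction X g v \<in> nucleus"
    using eventually_in_nucleus by metis
  \<comment> \<open>the successor makes \<open>n + m\<close> a legitimate index of the sequence, which starts at \<open>1\<close>\<close>
  define n where "n = Suc (Max (\<kappa> ` g ` {1..}))"
  have n: "\<kappa> (g k) \<le> n" if "k \<ge> 1" for k
    using that fin unfolding n_def by (intro le_SucI Max_ge) auto
  show ?thesis
  proof (rule pi_eq_limit[OF w])
    fix m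
    define v t t' where "v = last_letters n ((shift ^^ m) w)" and "t = last_letters m w"
      and "t' = last_letters m w'"
    have mem: "v \<in> lists X" "t \<in> lists X" "t' \<in> lists X"
      unfolding v_def t_def t'_def by (intro last_letters_in_lists shift_in_left_words w)+
    have pos: "n + m \<ge> 1" by (simp add: n_def)
    define h where "h = restriction X (g (n + m)) v"
    have h: "h \<in> nucleus" unfolding h_def
      using \<kappa>[OF g[OF pos] mem(1)] n[OF pos] by (simp add: v_def)
    have "g (n + m) v @ h t = last_letters n ((shift ^^ m) w') @ t'"
      using maps[OF pos] restriction_eq[OF nucleus_group_tree_automorphism[OF g[OF pos]] mem(1,2)]
      by (simp add: last_letters_add h_def v_def t_def t'_def)
    moreover have "length (h t) = length t'"
      using tree_automorphism_length[OF nucleus_tree_automorphism[OF h] mem(2)]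
      by (simp add: t_def t'_def)
    ultimately have ht: "h t = t'" by simp
    show "\<exists>u\<in>words. \<pi> (fold append_letter (last_letters m w) u) =
        \<pi> (fold append_letter (last_letters m w') u)"
      using h
    proof (cases rule: nucleus_cases)
      case one
      then have "t = t'" using ht mem by simp
      then show ?thesis using w by (auto simp: t_def t'_def)
    next
      case (relabelling \<phi> k)
      obtain u where u: "u \<in> words" "\<pi> u = k"
        using pi_surj[OF boundary_in_K[OF relabelling(2)]] by blast
      have "fold F t' k = fold F t k"
        using ht relabelling mem fold_F_relabel[of \<phi> t k] by (simp del: in_lists_conv_set)
      then show ?thesis
        using u mem by (intro bexI[of _ u]) (simp_all add: pi_fold flip: t_def t'_def)
    qed
  qed
qed

lemma limit_proj_nucleus_group:
  "w \<in> words \<Longrightarrow> limit_proj X nucleus_group w = {z \<in> words. \<pi> z = \<pi> w}"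
proof -
  assume w: "w \<in> words"
  have "(w, z) \<in> asymptotic_equivalence X nucleus_group \<longleftrightarrow> z \<in> words \<and> \<pi> z = \<pi> w" for z
  proof
    assume "(w, z) \<in> asymptotic_equivalence X nucleus_group"
    then show "z \<in> words \<and> \<pi> z = \<pi> w"
      using equal_pi_if_asymptotic[of w z] by (simp add: asymptotic_equivalence_def)
  next
    assume "z \<in> words \<and> \<pi> z = \<pi> w"
    then show "(w, z) \<in> asymptotic_equivalence X nucleus_group"
      using asymptotic_if_equal_pi[of w z] w by simp
  qed
  then show ?thesis by (simp add: limit_proj_def Image_singleton)
qed

lemma limit_space_isomorphic:
  "\<exists>F'. self_similar_structure (limit_space X nucleus_group) X F' \<and>
        associated_surjection (limit_space X nucleus_group) X F' (limit_proj X nucleus_group) \<and>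
        isomorphic_structures (limit_space X nucleus_group) X (limit_proj X nucleus_group) K X \<pi>"
proof -
  let ?J = "limit_space X nucleus_group" and ?p = "limit_proj X nucleus_group"
  have p: "quotient_map (left_words X) ?J ?p"
    unfolding limit_space_def by (rule quotient_map_quotient_topology)
  have ker: "?p x = ?p y \<longleftrightarrow> \<pi> x = \<pi> y" if "x \<in> words" "y \<in> words" for x y
    using that by (auto simp: limit_proj_nucleus_group)
  obtain h where h: "homeomorphic_map ?J K h" and hp: "\<And>x. x \<in> words \<Longrightarrow> h (?p x) = \<pi> x"
    using homeomorphic_map_of_equal_kernels[OF p quotient_map_pi ker] by metis
  obtain h' where hh': "homeomorphic_maps ?J K h h'"
    using h homeomorphic_map_maps by blast
  then have h': "continuous_map ?J K h" "continuous_map K ?J h'"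
    "\<And>y. y \<in> topspace ?J \<Longrightarrow> h' (h y) = y" "\<And>x. x \<in> topspace K \<Longrightarrow> h (h' x) = x"
    by (auto simp: homeomorphic_maps_def)
  have p_closed: "?p w \<in> topspace ?J" if "w \<in> words" for w
    using that quotient_imp_surjective_map[OF p] by blast
  have hK: "h y \<in> topspace K" if "y \<in> topspace ?J" for y
    using that h'(1) continuous_map_funspace by fastforce
  define F' where "F' i = h' \<circ> F i \<circ> h" for i
  have assoc: "associated_surjection ?J X F' ?p"
    unfolding associated_surjection_def
  proof (intro conjI ballI)
    fix i w assume iw: "i \<in> X" "w \<in> words"
    then have "F' i (?p w) = h' (h (?p (append_letter i w)))"
      by (simp add: F'_def hp pi_append append_letter_in_left_words)
    then show "F' i (?p w) = ?p (append_letter i w)"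
      using iw by (simp add: h' p_closed append_letter_in_left_words)
  qed (intro quotient_imp_continuous_map quotient_imp_surjective_map p)+
  have homeo: "?J homeomorphic_space K"
    using hh' by (auto simp: homeomorphic_space_def)
  have "continuous_map ?J ?J (F' i) \<and> inj_on (F' i) (topspace ?J)" if i: "i \<in> X" for i
  proof
    have "continuous_map K K (F i)" using struct i by (simp add: self_similar_structure_def)
    then show "continuous_map ?J ?J (F' i)"
      unfolding F'_def using h' continuous_map_compose by metis
    show "inj_on (F' i) (topspace ?J)"
    proof (rule inj_onI)
      fix x y assume xy: "x \<in> topspace ?J" "y \<in> topspace ?J" "F' i x = F' i y"
      then have "F i (h x) = F i (h y)"
        using h'(4) F_closed[OF i] hK unfolding F'_def by (metis comp_apply)
      then show "x = y" using F_inject[OF i] hK h'(3) xy by metis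
    qed
  qed
  then have "self_similar_structure ?J X F'"
    using assoc struct homeomorphic_compact_space[OF homeo] homeomorphic_metrizable_space[OF homeo]
    by (auto simp: self_similar_structure_def)
  moreover have "isomorphic_structures ?J X ?p K X \<pi>"
    unfolding isomorphic_structures_def
    by (intro exI[of _ id] exI[of _ h]) (use h hp in auto)
  ultimately show ?thesis using assoc by blast
qed

end


section \<open>The equivalence\<close>

text \<open>
  Equality of images under \<open>\<pi>\<close> is, up to the renaming \<open>\<rho>\<close> of letters, asymptotic equivalence, and
  the latter is preserved by the shift. The renaming commutes with the shift.
\<close>

lemma isomorphic_to_limit_space_imp_shift_compatible:
  assumes G: "self_similar_action X G"
    and iso: "isomorphic_structures (limit_space X G) X (limit_proj X G) K X \<pi>"
    and w: "w \<in> topspace (left_words X)" "w' \<in> topspace (left_words X)" "\<pi> w = \<pi> w'"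
  shows "\<pi> (shift w) = \<pi> (shift w')"
proof -
  let ?J = "limit_space X G" and ?p = "limit_proj X G"
  obtain \<rho> h where \<rho>: "bij_betw \<rho> X X" and h: "homeomorphic_map ?J K h"
    and hp: "\<And>u. u \<in> topspace (left_words X) \<Longrightarrow> h (?p u) = \<pi> (\<rho> \<circ> u)"
    using iso unfolding isomorphic_structures_def by blast
  have p: "quotient_map (left_words X) ?J ?p"
    unfolding limit_space_def by (rule quotient_map_quotient_topology)
  have equiv: "equiv (topspace (left_words X)) (asymptotic_equivalence X G)"
    using G by (intro equiv_asymptotic_equivalence) (simp add: self_similar_action_def)
  have eqv: "(u, u') \<in> asymptotic_equivalence X G \<longleftrightarrow> ?p u = ?p u'"
    if "u \<in> topspace (left_words X)" "u' \<in> topspace (left_words X)" for u u'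
    using that eq_equiv_class_iff[OF equiv] by (simp add: limit_proj_def)
  have pull: "\<exists>u\<in>topspace (left_words X). z = \<rho> \<circ> u" if "z \<in> topspace (left_words X)" for z
  proof (intro bexI[of _ "inv_into X \<rho> \<circ> z"])
    show "z = \<rho> \<circ> (inv_into X \<rho> \<circ> z)"
      using that \<rho> by (auto simp: mem_left_words bij_betw_inv_into_right)
    show "inv_into X \<rho> \<circ> z \<in> topspace (left_words X)"
      using that bij_betw_inv_into[OF \<rho>] by (auto simp: mem_left_words bij_betw_def)
  qed
  obtain u u' where u: "u \<in> topspace (left_words X)" "w = \<rho> \<circ> u"
    and u': "u' \<in> topspace (left_words X)" "w' = \<rho> \<circ> u'"
    using pull w by metis
  have "?p u \<in> topspace ?J" "?p u' \<in> topspace ?J"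
    using quotient_imp_surjective_map[OF p] u u' by blast+
  moreover have "h (?p u) = h (?p u')" using hp u u' w by simp
  ultimately have "?p u = ?p u'"
    using homeomorphic_imp_injective_map[OF h] by (auto dest: inj_onD)
  then have "(shift u, shift u') \<in> asymptotic_equivalence X G"
    using eqv u u' G by (intro shift_asymptotic_equivalence) (auto simp: self_similar_action_def)
  then have "h (?p (shift u)) = h (?p (shift u'))"
    using eqv u u' by (simp add: shift_in_left_words)
  moreover have "\<rho> \<circ> shift v = shift (\<rho> \<circ> v)" for v by (simp add: shift_def o_def)
  ultimately show ?thesis using hp u u' by (simp add: shift_in_left_words)
qed

theorem theorem5p9:
  fixes K :: "'k topology" and X :: "'x set"
    and F :: "'x \<Rightarrow> 'k \<Rightarrow> 'k" and \<pi> :: "(nat \<Rightarrow> 'x) \<Rightarrow> 'k"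
  assumes "self_similar_structure K X F"
    and "associated_surjection K X F \<pi>"
    and "post_critically_finite K X F \<pi>"
  shows "(\<exists>G. self_similar_action X G \<and> contracting X G \<and>
            (\<exists>F'. self_similar_structure (limit_space X G) X F' \<and>
                  associated_surjection (limit_space X G) X F' (limit_proj X G) \<and>
                  isomorphic_structures (limit_space X G) X (limit_proj X G) K X \<pi>))
         \<longleftrightarrow>
         (\<exists>s. s \<in> topspace K \<rightarrow> topspace K \<and>
              (\<forall>w\<in>topspace (left_words X). s (\<pi> w) = \<pi> (shift w)))"
    (is "?action \<longleftrightarrow> ?shift")
proof
  interpret self_similar K X F \<pi> using assms by unfold_locales
  assume ?action
  then obtain G where G: "self_similar_action X G"
    "isomorphic_structures (limit_space X G) X (limit_proj X G) K X \<pi>" by blast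
  define lift where "lift k = (SOME w. w \<in> words \<and> \<pi> w = k)" for k
  have lift: "lift k \<in> words" "\<pi> (lift k) = k" if "k \<in> topspace K" for k
    using someI_ex[of "\<lambda>w. w \<in> words \<and> \<pi> w = k"] pi_surj[OF that] unfolding lift_def by blast+
  show ?shift
  proof (intro exI[of _ "\<lambda>k. \<pi> (shift (lift k))"] conjI ballI Pi_I)
    fix w assume w: "w \<in> words"
    show "\<pi> (shift (lift (\<pi> w))) = \<pi> (shift w)"
      by (rule isomorphic_to_limit_space_imp_shift_compatible[OF G])
        (use lift[OF pi_closed[OF w]] w in auto)
  qed (simp add: lift pi_closed shift_in_left_words)
next
  assume ?shift
  then obtain s where s: "\<And>w. w \<in> topspace (left_words X) \<Longrightarrow> s (\<pi> w) = \<pi> (shift w)" by blast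
  interpret shift_compatible K X F \<pi>
  proof unfold_locales
    fix w w' assume "w \<in> topspace (left_words X)" "w' \<in> topspace (left_words X)" "\<pi> w = \<pi> w'"
    then show "\<pi> (shift w) = \<pi> (shift w')" using s by metis
  qed (fact assms)+
  show ?action
    using self_similar_action_nucleus_group contracting_nucleus_group limit_space_isomorphic by blast
qed

end
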